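(* For every real $x\ge 2$ the limit $$D(x):=\lim_{y\to\infty}\frac1y\,\Big|\big\{A\in\mathbb{N}\setminus\{0\}:\ A\le y,\ q_p(A)\neq 0\ \text{ for all primes } p\le x\big\}\Big|$$ exists, i.e. the set of $A\in\mathbb{N}\setminus\{0\}$ with $q_p(A)\ne 0$ for all primes $p\le x$ has a natural density $D(x)$, and $D(x)=\frac{O(1)}{\log x}$. More precisely, as $x\to\infty$, $$D(x)\sim\frac{c}{\log x},\qquad c=e^{-\gamma}\prod_{p\ \mathrm{prime}}\Big(1+\frac{1}{p(p-1)}\Big)\approx 1.09125,$$ where $\gamma$ is Euler's constant.
   Context: For a prime $p$ and an integer $A$ not divisible by $p$, the Fermat quotient is $q_p(A)=\frac{A^{p-1}-1}{p}$, and "$q_p(A)=0$" means, by abuse of notation, $\frac{A^{p-1}-1}{p}\equiv 0\pmod p$, i.e. $A^{p-1}\equiv 1\pmod{p^2}$. The condition "$q_p(A)\neq 0$" means $A^{p-1}\not\equiv 1\pmod {p^2}$; in particular integers $A$ divisible by $p$ are counted as satisfying $q_p(A)\ne 0$. *)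

theory Defs
  imports
    "HOL-Analysis.Analysis"
    "HOL-Number_Theory.Number_Theory"
    "HOL-Library.Landau_Symbols"
begin

text \<open>
  For a prime p not dividing A the division below is exact. The (abusive) notation
  \<open>q\<^sub>p(A) = 0\<close> stands for a congruence modulo p; it is stated as a congruence modulo the
  square of p so that its negation holds for every A divisible by p. The two lemmas
  afterwards check both points.
\<close>

definition fermat_quotient :: "nat \<Rightarrow> int \<Rightarrow> int" where
  "fermat_quotient p A = (A ^ (p - 1) - 1) div int p"

definition fermat_quotient_zero :: "nat \<Rightarrow> int \<Rightarrow> bool" where
  "fermat_quotient_zero p A \<longleftrightarrow> [A ^ (p - 1) = 1] (mod (int p)\<^sup>2)"

lemma fermat_quotient_zero_iff:
  assumes "prime p" and "\<not> int p dvd A"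
  shows "int p * fermat_quotient p A = A ^ (p - 1) - 1"
    and "fermat_quotient_zero p A \<longleftrightarrow> [fermat_quotient p A = 0] (mod int p)"
proof -
  have p0: "int p \<noteq> 0" using assms(1) by auto
  have "coprime (int p) A"
    using assms by (intro prime_imp_coprime) auto
  moreover have "residues (int p)"
    using prime_gt_1_nat[OF assms(1)] by (simp add: residues_def)
  ultimately have "[A ^ totient p = 1] (mod int p)"
    using residues.euler_theorem[of "int p" A] by (simp add: coprime_commute)
  then show eq: "int p * fermat_quotient p A = A ^ (p - 1) - 1"
    by (simp add: totient_prime[OF assms(1)] cong_iff_dvd_diff fermat_quotient_def)
  have "fermat_quotient_zero p A \<longleftrightarrow> int p * int p dvd int p * fermat_quotient p A"
    unfolding eq fermat_quotient_zero_def by (simp add: cong_iff_dvd_diff power2_eq_square)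
  also have "\<dots> \<longleftrightarrow> int p dvd fermat_quotient p A"
    using p0 by simp
  finally show "fermat_quotient_zero p A \<longleftrightarrow> [fermat_quotient p A = 0] (mod int p)"
    by (simp add: cong_0_iff)
qed

lemma not_fermat_quotient_zero_if_dvd:
  assumes "prime p" and "int p dvd A"
  shows "\<not> fermat_quotient_zero p A"
proof
  assume "fermat_quotient_zero p A"
  then have "int p dvd A ^ (p - 1) - 1"
    unfolding fermat_quotient_zero_def cong_iff_dvd_diff power2_eq_square
    by (rule dvd_mult_left)
  moreover have "int p dvd A ^ (p - 1)"
    using assms(2) prime_gt_1_nat[OF assms(1)] by (intro dvd_trans[OF assms(2) dvd_power]) auto
  ultimately have "int p dvd A ^ (p - 1) - (A ^ (p - 1) - 1)"
    by (rule dvd_diff[rotated])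
  then have "int p dvd 1" by simp
  then show False using assms(1) by auto
qed

definition nonvanishing_set :: "real \<Rightarrow> nat set" where
  "nonvanishing_set x =
     {A. A \<noteq> 0 \<and> (\<forall>p. prime p \<and> real p \<le> x \<longrightarrow> \<not> fermat_quotient_zero p (int A))}"

definition has_natural_density :: "nat set \<Rightarrow> real \<Rightarrow> bool" where
  "has_natural_density S d \<longleftrightarrow>
     ((\<lambda>y::real. real (card {A \<in> S. A \<noteq> 0 \<and> real A \<le> y}) / y) \<longlongrightarrow> d) at_top"

definition natural_density :: "nat set \<Rightarrow> real" where
  "natural_density S =
     Lim at_top (\<lambda>y::real. real (card {A \<in> S. A \<noteq> 0 \<and> real A \<le> y}) / y)"

definition D :: "real \<Rightarrow> real" where
  "D x = natural_density (nonvanishing_set x)"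

text \<open>The factor of the Euler product at n, set to 1 unless n is prime.\<close>

definition euler_factor :: "nat \<Rightarrow> real" where
  "euler_factor n = (if prime n then 1 + 1 / (real n * (real n - 1)) else 1)"

definition c_const :: real where
  "c_const = exp (- euler_mascheroni) * (\<Prod>n. euler_factor n)"

end

(*
  A unit modulo p has exactly one lift a mod p^2 with a^(p-1) = 1, namely the p-th power of any
  lift, so p - 1 residues mod p^2 are excluded and the Chinese remainder theorem gives
  D(x) = prod_{p <= x} (1 - 1/p + 1/p^2). Each factor is (1 - 1/p) (1 + 1/(p (p-1))), and the
  asymptotics reduce to Mertens' third theorem.

  Mertens' theorem is obtained by comparing two measures on the half-line: mass -ln(1 - 1/p) at
  ln p for every prime p, and mass 1/n at every n >= 1. The Laplace transforms at d are
  ln zeta(1 + d) + o(1) (Euler product) and -ln(1 - exp(-d)), both equal to -ln d + o(1) as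
  d -> 0+. Karamata's polynomial approximation of a step function then shows that the two measures
  have asymptotically the same mass on [0, u]; for the second one this is ln u + gamma + o(1) by
  the definition of gamma. No Chebyshev-type estimate is needed.

  The value of the constant uses prod (1 + 1/(p (p-1))) = zeta(2) zeta(3) / zeta(6).
*)
theory Submission
  imports Defs "HOL-Real_Asymp.Real_Asymp"
begin

section \<open>The density as a finite product\<close>

text \<open>Both measures have infinite mass, about ln u on [0, u], so their transforms diverge at
  0. A polynomial that is merely uniformly close to the step function is useless: at z = exp(- d t)
  near 1 an error e would be multiplied by almost all of the mass up to 1/d. The error is therefore
  required to be at most e (z - z^2), which vanishes at both ends of [0, 1] and whose integral
  against either measure stays bounded. The harmonic measure serves as a model. Only the difference
  of the two transforms has to tend to 0, so \<gamma> enters solely through the partial sums of 1/n,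
  and no integral has to be identified with it. The jump of the step function is paid for by a
  dilation of u by c > 1. The model mass grows logarithmically, so the dilation costs only ln c, and
  c may tend to 1.\<close>

text \<open>In x^p - y^p = (x - y) (x^(p-1) + ... + y^(p-1)) the second factor is congruent to p
  y^(p-1), so each of the two factors contributes one p.\<close>

lemma power_cong_mod_square:
  fixes x y :: int
  assumes "[x = y] (mod int p)"
  shows "[x ^ p = y ^ p] (mod (int p)\<^sup>2)"
proof -
  have "[(\<Sum>i<p. y ^ (p - Suc i) * x ^ i) = (\<Sum>i<p. y ^ (p - Suc i) * y ^ i)] (mod int p)"
    by (intro cong_sum cong_mult cong_pow assms cong_refl)
  also have "(\<Sum>i<p. y ^ (p - Suc i) * y ^ i) = (\<Sum>i<p. y ^ (p - 1))"
    by (intro sum.cong) (auto simp flip: power_add)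
  also have "\<dots> = int p * y ^ (p - 1)" by simp
  finally have "int p dvd (\<Sum>i<p. y ^ (p - Suc i) * x ^ i)"
    by (simp add: cong_dvd_iff)
  moreover have "int p dvd x - y" using assms by (simp add: cong_iff_dvd_diff)
  ultimately have "int p * int p dvd (x - y) * (\<Sum>i<p. y ^ (p - Suc i) * x ^ i)"
    by (intro mult_dvd_mono)
  then show ?thesis
    by (simp add: cong_iff_dvd_diff power2_eq_square power_diff_sumr2)
qed

lemma fermat_quotient_zero_cong:
  "[a = b] (mod p\<^sup>2) \<Longrightarrow> fermat_quotient_zero p (int a) \<longleftrightarrow> fermat_quotient_zero p (int b)"
proof -
  assume "[a = b] (mod p\<^sup>2)"
  then have "[int a = int b] (mod (int p)\<^sup>2)" by (metis cong_int_iff of_nat_power)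
  then have "[int a ^ (p - 1) = int b ^ (p - 1)] (mod (int p)\<^sup>2)" by (rule cong_pow)
  then show ?thesis unfolding fermat_quotient_zero_def by (meson cong_sym cong_trans)
qed

text \<open>Reduction modulo p maps the solutions bijectively onto the nonzero residues. It is
  injective because a solution equals its own p-th power modulo p^2, and that power depends only on
  the residue modulo p. It is surjective because Euler's theorem with totient p (p - 1) makes r^p a
  solution, and Fermat's little theorem places it above r.\<close>

lemma card_fermat_quotient_zero:
  assumes "prime p"
  shows "card {a. a < p\<^sup>2 \<and> fermat_quotient_zero p (int a)} = p - 1"
proof -
  have p: "1 < p" using assms prime_gt_1_nat by blast
  have fq: "fermat_quotient_zero p (int a) \<longleftrightarrow> [a ^ (p - 1) = 1] (mod p\<^sup>2)" for a
    unfolding fermat_quotient_zero_def by (metis cong_int_iff of_nat_1 of_nat_power)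
  have lift: "[a ^ p = b ^ p] (mod p\<^sup>2)" if "[a = b] (mod p)" for a b
    using power_cong_mod_square[of "int a" "int b" p] that
    by (metis cong_int_iff of_nat_power)
  have fix_p: "[a ^ p = a] (mod p\<^sup>2)" if "fermat_quotient_zero p (int a)" for a
    using cong_mult[OF that[unfolded fq] cong_refl[of a]] p by (simp flip: power_Suc2)
  have "bij_betw (\<lambda>a. a mod p) {a. a < p\<^sup>2 \<and> fermat_quotient_zero p (int a)} {1..<p}"
  proof (rule bij_betwI')
    fix a b assume a: "a \<in> {a. a < p\<^sup>2 \<and> fermat_quotient_zero p (int a)}"
      and b: "b \<in> {a. a < p\<^sup>2 \<and> fermat_quotient_zero p (int a)}"
    show "(a mod p = b mod p) \<longleftrightarrow> a = b"
    proof
      assume "a mod p = b mod p"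
      then have "[a ^ p = b ^ p] (mod p\<^sup>2)" by (intro lift) (simp add: cong_def)
      moreover have "[a ^ p = a] (mod p\<^sup>2)" "[b ^ p = b] (mod p\<^sup>2)" using a b fix_p by auto
      ultimately have "[a = b] (mod p\<^sup>2)" by (simp add: cong_def)
      then show "a = b" using a b by (simp add: cong_def)
    qed simp
  next
    fix a assume a: "a \<in> {a. a < p\<^sup>2 \<and> fermat_quotient_zero p (int a)}"
    then have "\<not> p dvd a" using not_fermat_quotient_zero_if_dvd[OF assms, of "int a"] by auto
    then show "a mod p \<in> {1..<p}" using p by (auto simp: Suc_le_eq dvd_eq_mod_eq_0)
  next
    fix r assume r: "r \<in> {1..<p}"
    define a where "a = r ^ p mod p\<^sup>2"
    have "\<not> p dvd r" using r by (auto dest: dvd_imp_le)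
    then have cop: "coprime r p" using assms by (simp add: coprime_commute prime_imp_coprime)
    have "[r ^ totient (p\<^sup>2) = 1] (mod p\<^sup>2)"
      using cop by (intro euler_theorem) simp
    also have "r ^ totient (p\<^sup>2) = (r ^ p) ^ (p - 1)"
      using totient_prime_power[OF assms, of 2] by (simp add: power_mult)
    finally have "[a ^ (p - 1) = 1] (mod p\<^sup>2)"
      unfolding a_def by (simp add: cong_def power_mod)
    moreover have "a < p\<^sup>2" using p by (simp add: a_def)
    moreover have "r = a mod p"
    proof -
      have "[r ^ (p - 1) = 1] (mod p)" using assms \<open>\<not> p dvd r\<close> by (rule fermat_theorem)
      from cong_mult[OF this cong_refl[of r]] have "[r ^ p = r] (mod p)"
        using p by (simp flip: power_Suc2)
      then have "r ^ p mod p = r" using r by (simp add: cong_def)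
      then show ?thesis by (simp add: a_def power2_eq_square mod_mod_cancel)
    qed
    ultimately show "\<exists>a\<in>{a. a < p\<^sup>2 \<and> fermat_quotient_zero p (int a)}. r = a mod p"
      by (auto simp: fq)
  qed
  then show ?thesis using bij_betw_same_card by fastforce
qed

lemma card_not_fermat_quotient_zero:
  assumes "prime p"
  shows "card {a. a < p\<^sup>2 \<and> \<not> fermat_quotient_zero p (int a)} = p\<^sup>2 - (p - 1)"
proof -
  have "{a. a < p\<^sup>2 \<and> \<not> fermat_quotient_zero p (int a)} =
      {..<p\<^sup>2} - {a. a < p\<^sup>2 \<and> fermat_quotient_zero p (int a)}" by auto
  also have "card \<dots> = p\<^sup>2 - (p - 1)"
    using card_fermat_quotient_zero[OF assms] by (subst card_Diff_subset) auto
  finally show ?thesis .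
qed

section \<open>Chinese remainder theorem and densities of periodic sets\<close>

lemma card_crt:
  fixes m n :: nat
  assumes "coprime m n" "0 < m" "0 < n"
    and P: "\<And>a b. [a = b] (mod m) \<Longrightarrow> P a \<longleftrightarrow> P b" and Q: "\<And>a b. [a = b] (mod n) \<Longrightarrow> Q a \<longleftrightarrow> Q b"
  shows "card {a. a < m * n \<and> P a \<and> Q a} = card {a. a < m \<and> P a} * card {a. a < n \<and> Q a}"
proof -
  have "bij_betw (\<lambda>a. (a mod m, a mod n)) {a. a < m * n \<and> P a \<and> Q a} ({a. a < m \<and> P a} \<times> {a. a < n \<and> Q a})"
  proof (rule bij_betwI')
    fix a b assume a: "a \<in> {a. a < m * n \<and> P a \<and> Q a}" and b: "b \<in> {a. a < m * n \<and> P a \<and> Q a}"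
    show "((a mod m, a mod n) = (b mod m, b mod n)) \<longleftrightarrow> a = b"
    proof
      assume "(a mod m, a mod n) = (b mod m, b mod n)"
      then have "[a = b] (mod m * n)"
        using assms(1) by (intro coprime_cong_mult_nat) (auto simp: cong_def)
      then show "a = b" using a b by (simp add: cong_def)
    qed simp
  next
    fix a assume a: "a \<in> {a. a < m * n \<and> P a \<and> Q a}"
    have "P (a mod m) \<longleftrightarrow> P a" "Q (a mod n) \<longleftrightarrow> Q a" by (intro P Q, simp)+
    with a show "(a mod m, a mod n) \<in> {a. a < m \<and> P a} \<times> {a. a < n \<and> Q a}"
      using assms(2,3) by simp
  next
    fix y assume "y \<in> {a. a < m \<and> P a} \<times> {a. a < n \<and> Q a}"
    then obtain u v where y: "y = (u, v)" "u < m" "P u" "v < n" "Q v" by auto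
    obtain a where a: "a < m * n" "[a = u] (mod m)" "[a = v] (mod n)"
      using binary_chinese_remainder_unique_nat[OF assms(1), of u v] assms by auto
    then show "\<exists>a\<in>{a. a < m * n \<and> P a \<and> Q a}. y = (a mod m, a mod n)"
      using y P[OF a(2)] Q[OF a(3)] by (intro bexI[of _ a]) (auto simp: cong_def)
  qed
  then show ?thesis by (simp add: bij_betw_same_card card_cartesian_product)
qed

lemma card_nonvanishing_residues:
  assumes "finite S" "\<And>p. p \<in> S \<Longrightarrow> prime p"
  shows "card {a. a < (\<Prod>p\<in>S. p\<^sup>2) \<and> (\<forall>p\<in>S. \<not> fermat_quotient_zero p (int a))} = (\<Prod>p\<in>S. p\<^sup>2 - (p - 1))"
  using assms
proof (induction S rule: finite_induct)
  case (insert p S)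
  have pr: "prime p" "\<And>q. q \<in> S \<Longrightarrow> prime q" using insert by auto
  have cop: "coprime (p\<^sup>2) (\<Prod>p\<in>S. p\<^sup>2)"
    using insert pr by (intro prod_coprime_right) (auto intro!: primes_coprime)
  have "card {a. a < p\<^sup>2 * (\<Prod>p\<in>S. p\<^sup>2) \<and> \<not> fermat_quotient_zero p (int a) \<and> (\<forall>p\<in>S. \<not> fermat_quotient_zero p (int a))} =
     card {a. a < p\<^sup>2 \<and> \<not> fermat_quotient_zero p (int a)} *
     card {a. a < (\<Prod>p\<in>S. p\<^sup>2) \<and> (\<forall>p\<in>S. \<not> fermat_quotient_zero p (int a))}"
  proof (rule card_crt[OF cop])
    fix a b assume ab: "[a = b] (mod (\<Prod>p\<in>S. p\<^sup>2))"
    have "[a = b] (mod q\<^sup>2)" if "q \<in> S" for q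
      using ab by (rule cong_dvd_modulus_nat) (use that insert in \<open>auto intro: dvd_prodI\<close>)
    then show "(\<forall>p\<in>S. \<not> fermat_quotient_zero p (int a)) \<longleftrightarrow> (\<forall>p\<in>S. \<not> fermat_quotient_zero p (int b))"
      using fermat_quotient_zero_cong by blast
  qed (use fermat_quotient_zero_cong pr in \<open>auto intro!: prod_pos simp: prime_gt_0_nat\<close>)
  then show ?case
    using insert pr by (simp add: card_not_fermat_quotient_zero)
qed simp

lemma card_periodic_mult:
  fixes m k :: nat
  assumes "\<And>a. P (a + m) \<longleftrightarrow> P a"
  shows "card {a. a < k * m \<and> P a} = k * card {a. a < m \<and> P a}"
proof (induction k)
  case (Suc k)
  have shift: "P (a + k * m) \<longleftrightarrow> P a" for a
  proof (induction k)
    case (Suc k)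
    then show ?case using assms[of "a + k * m"] by (simp add: add_ac)
  qed simp
  have "{a. a < Suc k * m \<and> P a} = {a. a < k * m \<and> P a} \<union> (\<lambda>a. a + k * m) ` {a. a < m \<and> P a}"
  proof (rule Set.set_eqI, rule iffI)
    fix a assume a: "a \<in> {a. a < Suc k * m \<and> P a}"
    show "a \<in> {a. a < k * m \<and> P a} \<union> (\<lambda>a. a + k * m) ` {a. a < m \<and> P a}"
    proof (cases "a < k * m")
      case False
      then have "a = (a - k * m) + k * m" by simp
      moreover from this have "P (a - k * m)" using shift[of "a - k * m"] a by auto
      ultimately show ?thesis using a False by (intro UnI2 image_eqI[of _ _ "a - k * m"]) auto
    qed (use a in auto)
  qed (auto simp: shift)
  also have "card \<dots> = card {a. a < k * m \<and> P a} + card ((\<lambda>a. a + k * m) ` {a. a < m \<and> P a})"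
    by (intro card_Un_disjoint) auto
  also have "card ((\<lambda>a. a + k * m) ` {a. a < m \<and> P a}) = card {a. a < m \<and> P a}"
    by (intro card_image) auto
  finally show ?case using Suc by simp
qed simp

lemma has_natural_density_periodic:
  fixes m :: nat
  assumes "0 < m" and per: "\<And>a. P (a + m) \<longleftrightarrow> P a"
  shows "has_natural_density {a. a \<noteq> 0 \<and> P a} (card {a. a < m \<and> P a} / m)"
proof -
  define r where "r = card {a. a < m \<and> P a}"
  define C where "C y = real (card {a. a \<noteq> 0 \<and> P a \<and> real a \<le> y})" for y
  have "(y / m - 1) * r - 1 \<le> C y \<and> C y \<le> (y / m + 1) * r" if "1 \<le> y" for y
  proof -
    define k where "k = nat \<lfloor>y / m\<rfloor>"
    have k: "real k \<le> y / m" "y / m < real k + 1" using that by (simp_all add: k_def)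
    have k': "real (k * m) \<le> y" "y < real ((k + 1) * m)" using k assms(1) by (simp_all add: field_simps)
    have fin: "finite {a. a \<noteq> 0 \<and> P a \<and> real a \<le> y}"
      by (rule finite_subset[of _ "{..nat \<lfloor>y\<rfloor>}"]) (auto simp: le_nat_floor)
    have "card {a. a \<noteq> 0 \<and> P a \<and> real a \<le> y} \<le> card {a. a < (k + 1) * m \<and> P a}"
    proof (rule card_mono)
      show "{a. a \<noteq> 0 \<and> P a \<and> real a \<le> y} \<subseteq> {a. a < (k + 1) * m \<and> P a}"
        using k'(2) by (auto simp del: of_nat_mult dest: order_le_less_trans)
    qed simp
    also have "\<dots> = (k + 1) * r" unfolding r_def using per by (rule card_periodic_mult)
    finally have "C y \<le> real ((k + 1) * r)" unfolding C_def by (intro of_nat_mono)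
    also have "\<dots> = (real k + 1) * r" by (simp add: algebra_simps)
    also have "\<dots> \<le> (y / m + 1) * r" using k by (intro mult_right_mono) auto
    finally have up: "C y \<le> (y / m + 1) * r" .
    have "k * r = card {a. a < k * m \<and> P a}" unfolding r_def using per by (rule card_periodic_mult[symmetric])
    \<comment> \<open>The full periods start at 0, which the density does not count. The resulting
      loss of at most 1 disappears after division by y.\<close>
    also have "\<dots> \<le> card (insert 0 {a. a \<noteq> 0 \<and> P a \<and> real a \<le> y})"
    proof (rule card_mono)
      have "real a \<le> y" if "a < k * m" for a
        using k'(1) that by (metis of_nat_less_iff less_imp_le order_trans)
      then show "{a. a < k * m \<and> P a} \<subseteq> insert 0 {a. a \<noteq> 0 \<and> P a \<and> real a \<le> y}"
        by auto
    qed (use fin in simp)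
    also have "\<dots> \<le> card {a. a \<noteq> 0 \<and> P a \<and> real a \<le> y} + 1" using fin by simp
    finally have "real (k * r) \<le> C y + 1" unfolding C_def by (metis of_nat_1 of_nat_add of_nat_mono)
    moreover have "(y / m - 1) * r \<le> real k * r" using k by (intro mult_right_mono) auto
    ultimately have lo: "(y / m - 1) * r - 1 \<le> C y" by simp
    show ?thesis using up lo by simp
  qed
  then have b: "\<forall>\<^sub>F y in at_top. ((y / m - 1) * r - 1) / y \<le> C y / y"
    "\<forall>\<^sub>F y in at_top. C y / y \<le> ((y / m + 1) * r) / y"
    by (auto intro!: eventually_mono[OF eventually_ge_at_top[of 1]] divide_right_mono)
  have m: "real m > 0" using assms by simp
  have inf: "filterlim (\<lambda>y::real. y) at_infinity at_top"
    by (intro filterlim_at_top_imp_at_infinity filterlim_ident)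
  have "((\<lambda>y. C y / y) \<longlongrightarrow> r / m) at_top"
  proof (rule tendsto_sandwich[OF b])
    have "((\<lambda>y. r / m - (real r + 1) / y) \<longlongrightarrow> r / m) at_top"
      using tendsto_diff[OF tendsto_const tendsto_divide_0[OF tendsto_const inf]] by simp
    moreover have "\<forall>\<^sub>F y in at_top. r / m - (real r + 1) / y = ((y / m - 1) * r - 1) / y"
      using eventually_gt_at_top[of 0] by eventually_elim (use m in \<open>simp add: field_simps\<close>)
    ultimately show "((\<lambda>y. ((y / m - 1) * r - 1) / y) \<longlongrightarrow> r / m) at_top"
      by (rule Lim_transform_eventually)
    have "((\<lambda>y. r / m + real r / y) \<longlongrightarrow> r / m) at_top"
      using tendsto_add[OF tendsto_const tendsto_divide_0[OF tendsto_const inf]] by simp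
    moreover have "\<forall>\<^sub>F y in at_top. r / m + real r / y = ((y / m + 1) * r) / y"
      using eventually_gt_at_top[of 0] by eventually_elim (use m in \<open>simp add: field_simps\<close>)
    ultimately show "((\<lambda>y. ((y / m + 1) * r) / y) \<longlongrightarrow> r / m) at_top"
      by (rule Lim_transform_eventually)
  qed
  then show ?thesis
    unfolding has_natural_density_def C_def r_def by (simp add: conj_ac cong: conj_cong)
qed

lemma density_nonvanishing_set:
  shows "has_natural_density (nonvanishing_set x) (\<Prod>p | prime p \<and> real p \<le> x. 1 - 1 / real p + 1 / (real p)\<^sup>2)"
    and "D x = (\<Prod>p | prime p \<and> real p \<le> x. 1 - 1 / real p + 1 / (real p)\<^sup>2)"
proof -
  define S where "S = {p. prime p \<and> real p \<le> x}"
  define m where "m = (\<Prod>p\<in>S. p\<^sup>2)"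
  have S: "finite S" "\<And>p. p \<in> S \<Longrightarrow> prime p"
    unfolding S_def by (rule finite_subset[of _ "{..nat \<lfloor>x\<rfloor>}"], auto simp: le_nat_floor)
  have "0 < m" unfolding m_def using S by (auto intro!: prod_pos simp: prime_gt_0_nat)
  have "fermat_quotient_zero p (int (a + m)) \<longleftrightarrow> fermat_quotient_zero p (int a)" if "p \<in> S" for p a
  proof (rule fermat_quotient_zero_cong)
    have "p\<^sup>2 dvd m" unfolding m_def using that S by (intro dvd_prodI) auto
    then show "[a + m = a] (mod p\<^sup>2)" by (simp add: cong_def mod_add_right_eq[symmetric, of a m] flip: dvd_eq_mod_eq_0)
  qed
  then have "has_natural_density {a. a \<noteq> 0 \<and> (\<forall>p\<in>S. \<not> fermat_quotient_zero p (int a))}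
    (real (card {a. a < m \<and> (\<forall>p\<in>S. \<not> fermat_quotient_zero p (int a))}) / m)"
    by (intro has_natural_density_periodic \<open>0 < m\<close>) blast
  also have "{a. a \<noteq> 0 \<and> (\<forall>p\<in>S. \<not> fermat_quotient_zero p (int a))} = nonvanishing_set x"
    unfolding nonvanishing_set_def S_def by auto
  also have "card {a. a < m \<and> (\<forall>p\<in>S. \<not> fermat_quotient_zero p (int a))} = (\<Prod>p\<in>S. p\<^sup>2 - (p - 1))"
    unfolding m_def by (rule card_nonvanishing_residues[OF S])
  also have "real (\<Prod>p\<in>S. p\<^sup>2 - (p - 1)) / m =
      (\<Prod>p\<in>S. 1 - 1 / real p + 1 / (real p)\<^sup>2)"
    unfolding m_def of_nat_prod prod_dividef[symmetric]
  proof (intro prod.cong refl)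
    fix p assume "p \<in> S"
    then have "1 < p" using S prime_gt_1_nat by blast
    \<comment> \<open>Ensures that the natural subtraction in \<open>p\<^sup>2 - (p - 1)\<close> is
      not truncated.\<close>
    have "p - 1 \<le> p\<^sup>2" using le_square[of p] unfolding power2_eq_square by linarith
    with \<open>1 < p\<close> show "real (p\<^sup>2 - (p - 1)) / real (p\<^sup>2) = 1 - 1 / real p + 1 / (real p)\<^sup>2"
      by (simp add: of_nat_diff field_simps power2_eq_square)
  qed
  finally show *: "has_natural_density (nonvanishing_set x) (\<Prod>p | prime p \<and> real p \<le> x. 1 - 1 / real p + 1 / (real p)\<^sup>2)"
    unfolding S_def .
  then show "D x = (\<Prod>p | prime p \<and> real p \<le> x. 1 - 1 / real p + 1 / (real p)\<^sup>2)"
    unfolding D_def natural_density_def has_natural_density_def by (intro tendsto_Lim) auto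
qed

section \<open>A Tauberian comparison theorem\<close>

text \<open>To obtain an error weighted by z - z^2, Weierstrass is applied not to a ramp between the
  two steps but to the ramp minus z, divided by z - z^2. This quotient extends continuously to
  [0, 1] because the ramp is 0 near 0 and 1 near 1. In the partial fractions the clamps
  \<open>max z a\<close> and \<open>min z b\<close> keep the denominators positive and alter only
  terms whose numerator is 0.\<close>

lemma polynomial_sandwich_step:
  fixes a b \<epsilon> :: real
  assumes "0 < a" "a < b" "b < 1" "0 < \<epsilon>"
  obtains q where "real_polynomial_function q"
    and "\<And>z. 0 \<le> z \<Longrightarrow> z \<le> 1 \<Longrightarrow> of_bool (b \<le> z) - \<epsilon> * (z - z\<^sup>2) \<le> z + (z - z\<^sup>2) * q z"
    and "\<And>z. 0 \<le> z \<Longrightarrow> z \<le> 1 \<Longrightarrow> z + (z - z\<^sup>2) * q z \<le> of_bool (a \<le> z) + \<epsilon> * (z - z\<^sup>2)"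
proof -
  \<comment> \<open>\<open>\<tau>\<close> is a ramp from 0 at a to 1 at b, and g is chosen so that \<open>z + (z - z\<^sup>2) * g z = \<tau> z\<close>.\<close>
  define \<tau> where "\<tau> z = max 0 (min 1 ((z - a) / (b - a)))" for z
  define g where "g z = \<tau> z / max z a - (1 - \<tau> z) / (1 - min z b)" for z
  have "continuous_on {0..1} g"
    unfolding g_def \<tau>_def using assms by (intro continuous_intros) auto
  then obtain q where q: "real_polynomial_function q" "\<And>z. z \<in> {0..1} \<Longrightarrow> \<bar>g z - q z\<bar> < \<epsilon>"
    using Stone_Weierstrass_real_polynomial_function[of "{0..1::real}" g \<epsilon>] assms(4) by auto
  have *: "z + (z - z\<^sup>2) * g z = \<tau> z" for z
  proof (cases "z \<le> a")
    case True
    then have "\<tau> z = 0" using assms by (auto simp: \<tau>_def divide_nonpos_pos max_absorb1 min_le_iff_disj)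
    with True assms show ?thesis by (simp add: g_def power2_eq_square field_simps)
  next
    case False
    show ?thesis
    proof (cases "b \<le> z")
      case True
      then have "\<tau> z = 1" using assms by (simp add: \<tau>_def)
      with False assms show ?thesis by (simp add: g_def power2_eq_square field_simps)
    next
      case F2: False
      have "(z - z\<^sup>2) * g z = (z * (1 - z)) * (\<tau> z / z - (1 - \<tau> z) / (1 - z))"
        using False F2 by (simp add: g_def power2_eq_square algebra_simps)
      also have "\<dots> = \<tau> z * (1 - z) - (1 - \<tau> z) * z"
        using False F2 assms by (simp add: divide_simps)
      finally show ?thesis by (simp add: algebra_simps)
    qed
  qed
  have lower: "of_bool (b \<le> z) \<le> \<tau> z" for z
    using assms by (auto simp: \<tau>_def)
  have upper: "\<tau> z \<le> of_bool (a \<le> z)" for z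
    using assms by (auto simp: \<tau>_def divide_nonpos_pos)
  have close: "\<bar>(z - z\<^sup>2) * q z - (z - z\<^sup>2) * g z\<bar> \<le> \<epsilon> * (z - z\<^sup>2)" if "0 \<le> z" "z \<le> 1" for z
  proof -
    have "0 \<le> z - z\<^sup>2" using that by (simp add: power2_eq_square mult_left_le_one_le)
    moreover have "\<bar>q z - g z\<bar> \<le> \<epsilon>" using q(2)[of z] that by (simp add: abs_minus_commute less_imp_le)
    ultimately have "(z - z\<^sup>2) * \<bar>q z - g z\<bar> \<le> (z - z\<^sup>2) * \<epsilon>" by (intro mult_left_mono)
    moreover have "\<bar>(z - z\<^sup>2) * q z - (z - z\<^sup>2) * g z\<bar> = (z - z\<^sup>2) * \<bar>q z - g z\<bar>"
      using \<open>0 \<le> z - z\<^sup>2\<close> by (simp add: abs_mult flip: right_diff_distrib)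
    ultimately show ?thesis by (simp add: mult.commute)
  qed
  show ?thesis
  proof (rule that[OF q(1)])
    fix z :: real assume z: "0 \<le> z" "z \<le> 1"
    show "of_bool (b \<le> z) - \<epsilon> * (z - z\<^sup>2) \<le> z + (z - z\<^sup>2) * q z"
      using close[OF z] *[of z] lower[of z] by linarith
    show "z + (z - z\<^sup>2) * q z \<le> of_bool (a \<le> z) + \<epsilon> * (z - z\<^sup>2)"
      using close[OF z] *[of z] upper[of z] by linarith
  qed
qed

text \<open>Laplace transform at \<delta> of the measure with mass \<open>w n\<close> at the point
  \<open>t n\<close>. In both applications index 0 carries no mass: 0 is not prime, and
  \<open>1 / real 0 = 0\<close>.\<close>

definition laplace_sum :: "(nat \<Rightarrow> real) \<Rightarrow> (nat \<Rightarrow> real) \<Rightarrow> real \<Rightarrow> real" where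
  "laplace_sum w t \<delta> = (\<Sum>n. w n * exp (- \<delta> * t n))"

text \<open>The i-th power of exp (- \<delta> t) is its value at i \<delta>, so integrating a
  polynomial needs only values of the transform. The condition \<open>P 0 = 0\<close> removes the
  exponent 0, which would ask for the possibly infinite total mass. The coefficients are obtained
  before the measure, so one linear combination serves both measures.\<close>

lemma laplace_sum_polynomial:
  fixes P :: "real \<Rightarrow> real"
  assumes "real_polynomial_function P" and "P 0 = 0"
  obtains a N where "\<forall>w t \<delta>. (\<forall>d>0. summable (\<lambda>n. w n * exp (- d * t n))) \<longrightarrow> 0 < \<delta> \<longrightarrow>
    (\<lambda>n. w n * P (exp (- \<delta> * t n))) sums (\<Sum>i=1..N. a i * laplace_sum w t (real i * \<delta>))"
proof -
  obtain a N where P: "P = (\<lambda>x. \<Sum>i\<le>N. a i * x ^ i)"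
    using assms(1) real_polynomial_function_iff_sum by blast
  have "a 0 = 0" using assms(2) unfolding P by (simp add: power_0_left if_distrib cong: if_cong)
  then have P': "P x = (\<Sum>i=1..N. a i * x ^ i)" for x
    unfolding P by (intro sum.mono_neutral_right) (auto simp: not_less_eq_eq)
  show ?thesis
  proof (rule that, intro allI impI)
    fix w t :: "nat \<Rightarrow> real" and \<delta> :: real
    assume sm: "\<forall>d>0. summable (\<lambda>n. w n * exp (- d * t n))" and "0 < \<delta>"
    have "(\<lambda>n. \<Sum>i=1..N. a i * (w n * exp (- (real i * \<delta>) * t n))) sums
        (\<Sum>i=1..N. a i * laplace_sum w t (real i * \<delta>))"
      unfolding laplace_sum_def using \<open>0 < \<delta>\<close>
      by (intro sums_sum sums_mult summable_sums sm[rule_format]) simp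
    moreover have "(\<Sum>i=1..N. a i * (w n * exp (- (real i * \<delta>) * t n))) = w n * P (exp (- \<delta> * t n))" for n
      unfolding P' sum_distrib_left
      by (intro sum.cong) (simp_all add: mult_ac flip: exp_of_nat_mult)
    ultimately show "(\<lambda>n. w n * P (exp (- \<delta> * t n))) sums (\<Sum>i=1..N. a i * laplace_sum w t (real i * \<delta>))"
      by simp
  qed
qed

lemma filterlim_mult_at_right_0:
  fixes c :: real
  assumes "0 < c"
  shows "filterlim (\<lambda>x. c * x) (at_right 0) (at_right 0)"
  using assms by (auto simp: filterlim_at eventually_at_right_less intro!: tendsto_eq_intros
      eventually_mono[OF eventually_at_right_less[of 0]])

text \<open>
  The error term \<open>\<epsilon> * (z - z\<^sup>2)\<close> of the polynomial approximation is integrated exactly: at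
  \<open>z = exp (- \<delta> * t)\<close> it is \<open>\<epsilon>\<close> times the Laplace transform at \<open>\<delta>\<close> minus that at \<open>2 * \<delta>\<close>,
  which stays bounded. Allowing the factor c > 1 avoids estimating the masses near the step.
\<close>

lemma laplace_tauberian_le:
  fixes w\<^sub>1 w\<^sub>2 t\<^sub>1 t\<^sub>2 :: "nat \<Rightarrow> real"
  assumes w: "\<And>n. 0 \<le> w\<^sub>1 n" "\<And>n. 0 \<le> w\<^sub>2 n" and t: "\<And>n. 0 \<le> t\<^sub>1 n" "\<And>n. 0 \<le> t\<^sub>2 n"
    and sm1: "\<And>d. 0 < d \<Longrightarrow> summable (\<lambda>n. w\<^sub>1 n * exp (- d * t\<^sub>1 n))"
    and sm2: "\<And>d. 0 < d \<Longrightarrow> summable (\<lambda>n. w\<^sub>2 n * exp (- d * t\<^sub>2 n))"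
    and lim: "((\<lambda>d. laplace_sum w\<^sub>1 t\<^sub>1 d - laplace_sum w\<^sub>2 t\<^sub>2 d) \<longlongrightarrow> 0) (at_right 0)"
    and lim1: "((\<lambda>d. laplace_sum w\<^sub>1 t\<^sub>1 d - laplace_sum w\<^sub>1 t\<^sub>1 (2 * d)) \<longlongrightarrow> l) (at_right 0)"
    and lim2: "((\<lambda>d. laplace_sum w\<^sub>2 t\<^sub>2 d - laplace_sum w\<^sub>2 t\<^sub>2 (2 * d)) \<longlongrightarrow> l) (at_right 0)"
    and "1 < c" "0 < \<epsilon>"
  shows "\<forall>\<^sub>F u in at_top. (\<Sum>n. w\<^sub>1 n * of_bool (t\<^sub>1 n \<le> u)) \<le> (\<Sum>n. w\<^sub>2 n * of_bool (t\<^sub>2 n \<le> c * u)) + \<epsilon>"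
proof -
  \<comment> \<open>K exceeds the common limit l of the doubling differences. The budget is
    \<epsilon>/2 for the difference of the polynomial integrals and e K = \<epsilon>/4 for the
    approximation error in each measure.\<close>
  define K where "K = \<bar>l\<bar> + 1"
  define e where "e = \<epsilon> / (4 * K)"
  have K: "K > 0" "l < K" by (auto simp: K_def)
  have e: "e > 0" "e * K = \<epsilon> / 4" using K assms by (simp_all add: e_def)
  \<comment> \<open>The transforms are evaluated at d = 1/u. With z = exp (- d t), the conditions t
    \<le> u and t \<le> c u become exp (-1) \<le> z and exp (-c) \<le> z.\<close>
  obtain q where q: "real_polynomial_function q"
    and lo: "\<And>z. 0 \<le> z \<Longrightarrow> z \<le> 1 \<Longrightarrow> of_bool (exp (-1) \<le> z) - e * (z - z\<^sup>2) \<le> z + (z - z\<^sup>2) * q z"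
    and up: "\<And>z. 0 \<le> z \<Longrightarrow> z \<le> 1 \<Longrightarrow> z + (z - z\<^sup>2) * q z \<le> of_bool (exp (-c) \<le> z) + e * (z - z\<^sup>2)"
    using polynomial_sandwich_step[of "exp (-c)" "exp (-1)" e] \<open>1 < c\<close> e by auto
  define P where "P z = z + (z - z\<^sup>2) * q z" for z
  have id: "real_polynomial_function (\<lambda>z::real. z)"
    by (rule real_polynomial_function.intros(1)[OF bounded_linear_ident])
  have P: "real_polynomial_function P" unfolding P_def power2_eq_square
    by (intro real_polynomial_function.intros(3,4) real_polynomial_function_diff q id)
  have P0: "P 0 = 0" by (simp add: P_def)
  obtain a N where aN: "\<forall>w t \<delta>. (\<forall>d>0. summable (\<lambda>n. w n * exp (- d * t n))) \<longrightarrow> 0 < \<delta> \<longrightarrow>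
    (\<lambda>n. w n * P (exp (- \<delta> * t n))) sums (\<Sum>i=1..N. a i * laplace_sum w t (real i * \<delta>))"
    by (rule laplace_sum_polynomial[OF P P0])
  define Q where "Q w t \<delta> = (\<Sum>i=1..N. a i * laplace_sum w t (real i * \<delta>))" for w t \<delta>
  define V where "V w t \<delta> = laplace_sum w t \<delta> - laplace_sum w t (2 * \<delta>)" for w t \<delta>
  have Vs: "(\<lambda>n. w n * (exp (- \<delta> * t n) - (exp (- \<delta> * t n))\<^sup>2)) sums V w t \<delta>"
    if "\<And>d. 0 < d \<Longrightarrow> summable (\<lambda>n. w n * exp (- d * t n))" "0 < \<delta>" for w t \<delta>
  proof -
    have "(\<lambda>n. w n * exp (- \<delta> * t n) - w n * exp (- (2 * \<delta>) * t n)) sums V w t \<delta>"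
      unfolding V_def laplace_sum_def using that by (intro sums_diff summable_sums) auto
    then show ?thesis by (simp add: algebra_simps flip: exp_double)
  qed
  \<comment> \<open>The divergent parts of the transforms cancel separately at each argument i d of
    the finite combination.\<close>
  have "((\<lambda>d. Q w\<^sub>1 t\<^sub>1 d - Q w\<^sub>2 t\<^sub>2 d) \<longlongrightarrow> (\<Sum>i=1..N. a i * 0)) (at_right 0)"
    unfolding Q_def sum_subtractf[symmetric] right_diff_distrib[symmetric]
    by (intro tendsto_sum tendsto_mult tendsto_const filterlim_compose[OF lim] filterlim_mult_at_right_0) auto
  then have "\<forall>\<^sub>F d in at_right 0. Q w\<^sub>1 t\<^sub>1 d - Q w\<^sub>2 t\<^sub>2 d < \<epsilon> / 2"
    using \<open>0 < \<epsilon>\<close> by (intro order_tendstoD) auto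
  moreover have "\<forall>\<^sub>F d in at_right 0. V w\<^sub>1 t\<^sub>1 d < K" "\<forall>\<^sub>F d in at_right 0. V w\<^sub>2 t\<^sub>2 d < K"
    unfolding V_def using lim1 lim2 K by (auto dest: order_tendstoD)
  moreover have "\<forall>\<^sub>F d::real in at_right 0. 0 < d" by (simp add: eventually_at_right_less)
  ultimately have "\<forall>\<^sub>F d in at_right 0.
    (\<Sum>n. w\<^sub>1 n * of_bool (t\<^sub>1 n \<le> inverse d)) \<le> (\<Sum>n. w\<^sub>2 n * of_bool (t\<^sub>2 n \<le> c * inverse d)) + \<epsilon>"
  proof eventually_elim
    case (elim d)
    note aN1 = aN[rule_format, of w\<^sub>1 t\<^sub>1 d, OF sm1 \<open>0 < d\<close>, folded Q_def]
    note aN2 = aN[rule_format, of w\<^sub>2 t\<^sub>2 d, OF sm2 \<open>0 < d\<close>, folded Q_def]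
    note V1 = Vs[of w\<^sub>1 t\<^sub>1 d, OF sm1 \<open>0 < d\<close>]
    note V2 = Vs[of w\<^sub>2 t\<^sub>2 d, OF sm2 \<open>0 < d\<close>]
    \<comment> \<open>The indicator of t \<le> r is at most exp (r - t), so the transform at 1
      dominates.\<close>
    have cnt: "summable (\<lambda>n. w n * of_bool (t n \<le> r))"
      if "\<And>n. 0 \<le> w n" "\<And>d. 0 < d \<Longrightarrow> summable (\<lambda>n. w n * exp (- d * t n))" for w t :: "nat \<Rightarrow> real" and r
    proof (rule summable_comparison_test'[where N = 0])
      show "summable (\<lambda>n. exp r * (w n * exp (- 1 * t n)))"
        using that(2)[of 1] by (intro summable_mult) simp
      show "norm (w n * of_bool (t n \<le> r)) \<le> exp r * (w n * exp (- 1 * t n))" for n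
        using that(1)[of n] mult_left_mono[of 1 "exp (r - t n)" "w n"]
        by (auto simp: exp_diff exp_minus field_simps)
    qed
    have z: "0 \<le> exp (- d * t\<^sub>1 n)" "exp (- d * t\<^sub>1 n) \<le> 1" "0 \<le> exp (- d * t\<^sub>2 n)" "exp (- d * t\<^sub>2 n) \<le> 1" for n
      using t[of n] \<open>0 < d\<close> by simp_all
    have b1: "t\<^sub>1 n \<le> inverse d \<longleftrightarrow> exp (-1) \<le> exp (- d * t\<^sub>1 n)" for n
      using \<open>0 < d\<close> by (simp add: field_simps)
    have b2: "t\<^sub>2 n \<le> c * inverse d \<longleftrightarrow> exp (-c) \<le> exp (- d * t\<^sub>2 n)" for n
      using \<open>0 < d\<close> by (simp add: field_simps)
    have "(\<Sum>n. w\<^sub>1 n * of_bool (t\<^sub>1 n \<le> inverse d)) \<le> Q w\<^sub>1 t\<^sub>1 d + e * V w\<^sub>1 t\<^sub>1 d"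
    proof (rule sums_le[OF _ summable_sums[OF cnt] sums_add[OF aN1 sums_mult[OF V1, of e]]])
      fix n
      have "w\<^sub>1 n * of_bool (t\<^sub>1 n \<le> inverse d) \<le>
          w\<^sub>1 n * (P (exp (- d * t\<^sub>1 n)) + e * (exp (- d * t\<^sub>1 n) - (exp (- d * t\<^sub>1 n))\<^sup>2))"
        using lo[OF z(1,2), of n] w(1) unfolding b1 P_def by (intro mult_left_mono) auto
      then show "w\<^sub>1 n * of_bool (t\<^sub>1 n \<le> inverse d) \<le> w\<^sub>1 n * P (exp (- d * t\<^sub>1 n)) +
        e * (w\<^sub>1 n * (exp (- d * t\<^sub>1 n) - (exp (- d * t\<^sub>1 n))\<^sup>2))" by (simp add: algebra_simps)
    qed (use w sm1 in auto)
    also have "\<dots> \<le> Q w\<^sub>2 t\<^sub>2 d + \<epsilon> / 2 + e * K"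
      using elim e by (intro add_mono mult_left_mono) auto
    also have "Q w\<^sub>2 t\<^sub>2 d \<le> (\<Sum>n. w\<^sub>2 n * of_bool (t\<^sub>2 n \<le> c * inverse d)) + e * V w\<^sub>2 t\<^sub>2 d"
    proof (rule sums_le[OF _ aN2 sums_add[OF summable_sums[OF cnt] sums_mult[OF V2, of e]]])
      fix n
      have "w\<^sub>2 n * P (exp (- d * t\<^sub>2 n)) \<le>
          w\<^sub>2 n * (of_bool (t\<^sub>2 n \<le> c * inverse d) + e * (exp (- d * t\<^sub>2 n) - (exp (- d * t\<^sub>2 n))\<^sup>2))"
        using up[OF z(3,4), of n] w(2) unfolding b2 P_def by (intro mult_left_mono) auto
      then show "w\<^sub>2 n * P (exp (- d * t\<^sub>2 n)) \<le> w\<^sub>2 n * of_bool (t\<^sub>2 n \<le> c * inverse d) +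
        e * (w\<^sub>2 n * (exp (- d * t\<^sub>2 n) - (exp (- d * t\<^sub>2 n))\<^sup>2))" by (simp add: algebra_simps)
    qed (use w sm2 in auto)
    also have "e * V w\<^sub>2 t\<^sub>2 d \<le> e * K" using elim e by (intro mult_left_mono) auto
    finally show ?case using e(2) by simp
  qed
  then have "\<forall>\<^sub>F u in at_top. (\<Sum>n. w\<^sub>1 n * of_bool (t\<^sub>1 n \<le> inverse (inverse u))) \<le>
      (\<Sum>n. w\<^sub>2 n * of_bool (t\<^sub>2 n \<le> c * inverse (inverse u))) + \<epsilon>"
    by (rule eventually_compose_filterlim) (rule filterlim_inverse_at_right_top)
  then show ?thesis by simp
qed

section \<open>The Euler product of the zeta function\<close>

text \<open>The term at 0 vanishes because \<open>0 powr a = 0\<close>.\<close>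

definition zeta_sum :: "real \<Rightarrow> real" where
  "zeta_sum s = (\<Sum>n. real n powr - s)"

lemma summable_zeta: "1 < s \<Longrightarrow> summable (\<lambda>n. real n powr - s)"
  by (simp add: summable_real_powr_iff)

text \<open>Sieve one prime at a time. Since divisibility by the other primes does not change under
  m -> p m, the multiples of p among the survivors carry p^(-s) times the whole sum, and removing
  them leaves the factor 1 - p^(-s). Unordered summation permits this reindexing.\<close>

lemma has_sum_coprime_zeta:
  assumes "1 < s" "finite S" "\<And>p. p \<in> S \<Longrightarrow> prime p"
  shows "((\<lambda>n. real n powr - s * of_bool (\<forall>p\<in>S. \<not> p dvd n)) has_sum
    (zeta_sum s * (\<Prod>p\<in>S. 1 - real p powr - s))) UNIV"
  using assms(2,3)
proof (induction S rule: finite_induct)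
  case empty
  have "((\<lambda>n. real n powr - s) has_sum zeta_sum s) UNIV"
    unfolding zeta_sum_def using summable_zeta[OF assms(1)]
    by (intro sums_nonneg_imp_has_sum summable_sums) auto
  then show ?case by simp
next
  case (insert p S)
  define f where "f n = real n powr - s * of_bool (\<forall>q\<in>S. \<not> q dvd n)" for n :: nat
  define Z where "Z = zeta_sum s * (\<Prod>p\<in>S. 1 - real p powr - s)"
  have IH: "(f has_sum Z) UNIV"
    unfolding f_def Z_def using insert by auto
  have p: "prime p" using insert by auto
  have "f (p * m) = real p powr - s * f m" for m
  proof -
    have "q dvd p * m \<longleftrightarrow> q dvd m" if "q \<in> S" for q
      using that insert p by (metis insertCI primes_dvd_imp_eq prime_dvd_mult_iff)
    then show ?thesis by (simp add: f_def powr_mult)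
  qed
  then have "((f \<circ> (*) p) has_sum (real p powr - s * Z)) UNIV"
    unfolding o_def using has_sum_cmult_right[OF IH, of "real p powr - s"] by simp
  then have "(f has_sum (real p powr - s * Z)) (range ((*) p))"
    using p by (subst has_sum_reindex) (auto intro!: inj_onI simp: prime_gt_0_nat)
  then have "((\<lambda>n. f n * of_bool (p dvd n)) has_sum (real p powr - s * Z)) UNIV"
    by (subst has_sum_cong_neutral[where g = f and T = "range ((*) p)"]) auto
  from has_sum_add[OF IH has_sum_uminusI[OF this]]
  have "((\<lambda>n. f n - f n * of_bool (p dvd n)) has_sum (Z - real p powr - s * Z)) UNIV" by simp
  also have "(\<lambda>n. f n - f n * of_bool (p dvd n)) =
      (\<lambda>n. real n powr - s * of_bool (\<forall>q\<in>insert p S. \<not> q dvd n))"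
    by (auto simp: f_def)
  also have "Z - real p powr - s * Z = zeta_sum s * (\<Prod>p\<in>insert p S. 1 - real p powr - s)"
    using insert by (simp add: Z_def algebra_simps)
  finally show ?case .
qed

text \<open>After sieving by all primes up to N, no n with 2 \<le> n \<le> N survives. The sieved
  sum thus lies between 1 and 1 plus a tail of the zeta series.\<close>

lemma euler_product_zeta:
  assumes "1 < s"
  shows "(\<lambda>N. zeta_sum s * (\<Prod>p | prime p \<and> p \<le> N. 1 - real p powr - s)) \<longlonglongrightarrow> 1"
proof (rule tendsto_sandwich)
  let ?Z = "\<lambda>N. zeta_sum s * (\<Prod>p | prime p \<and> p \<le> N. 1 - real p powr - s)"
  let ?c = "\<lambda>(N::nat) (n::nat). \<forall>p\<in>{p. prime p \<and> p \<le> N}. \<not> p dvd n"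
  have fin: "finite {p::nat. prime p \<and> p \<le> N}" for N by simp
  have *: "(\<lambda>n. real n powr - s * of_bool (?c N n)) sums ?Z N" for N
    by (rule has_sum_imp_sums[OF has_sum_coprime_zeta[OF assms fin]]) auto
  have c1: "?c N 1" for N by auto
  have c: "\<not> ?c N n" if n: "2 \<le> n" "n \<le> N" for n N
  proof -
    obtain p where "prime p" "p dvd n" using n prime_factor_nat[of n] by auto
    moreover from this have "p \<le> N" using n dvd_imp_le[of p n] by auto
    ultimately show ?thesis by auto
  qed
  show "\<forall>\<^sub>F N in sequentially. 1 \<le> ?Z N"
  proof (rule always_eventually, rule allI)
    fix N
    have "(\<lambda>n. if n = 1 then 1 else 0 :: real) sums 1" by (rule sums_single)
    then show "1 \<le> ?Z N" by (rule sums_le[OF _ _ *[of N], rotated]) (use c1 in auto)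
  qed
  define T where "T N = (\<Sum>n. real (n + (N + 1)) powr - s)" for N :: nat
  have "?Z N \<le> 1 + T N" for N
  proof -
    let ?g = "\<lambda>n. (if n = 1 then 1 else 0) + (if n \<le> N then 0 else real n powr - s)"
    have "(\<lambda>n. real (n + (N + 1)) powr - s) sums T N"
      unfolding T_def using summable_zeta[OF assms] by (intro summable_sums summable_ignore_initial_segment)
    then have "(\<lambda>n. if n + (N + 1) \<le> N then 0 else real (n + (N + 1)) powr - s) sums T N" by simp
    then have "(\<lambda>n. if n \<le> N then 0 else real n powr - s) sums T N"
      by (subst (asm) sums_zero_iff_shift) auto
    then have g: "?g sums (1 + T N)" by (intro sums_add sums_single)
    show ?thesis
    proof (rule sums_le[OF _ * g])
      fix n show "real n powr - s * of_bool (?c N n) \<le> ?g n"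
        using c[of n N] by (cases "n = 0"; cases "n = 1"; cases "n \<le> N") auto
    qed
  qed
  then show "\<forall>\<^sub>F N in sequentially. ?Z N \<le> 1 + T N" by simp
  have "(\<lambda>k. suminf (\<lambda>n. real n powr - s) - (\<Sum>n<k. real n powr - s)) \<longlonglongrightarrow>
      suminf (\<lambda>n. real n powr - s) - suminf (\<lambda>n. real n powr - s)"
    by (intro tendsto_diff tendsto_const summable_LIMSEQ summable_zeta assms)
  then have "(\<lambda>k. \<Sum>n. real (n + k) powr - s) \<longlonglongrightarrow> 0"
    by (simp only: suminf_minus_initial_segment[OF summable_zeta[OF assms]] diff_self)
  then have "T \<longlonglongrightarrow> 0"
    unfolding T_def by (rule LIMSEQ_ignore_initial_segment)
  then show "(\<lambda>N. 1 + T N) \<longlonglongrightarrow> 1" by (auto intro: tendsto_eq_intros)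
qed simp

lemma zeta_sum_ge_1: "1 < s \<Longrightarrow> 1 \<le> zeta_sum s"
  unfolding zeta_sum_def using sum_le_suminf[OF summable_zeta, of s "{1}"] by simp

lemma prime_powr_minus_less_1:
  assumes "prime (p::nat)" "0 < s"
  shows "real p powr - s < 1"
  using assms powr_less_mono[of "- s" 0 "real p"] prime_gt_1_nat[of p] by simp

text \<open>Each partial sum is ln zeta(s) minus the logarithm of zeta(s) times the finite Euler
  product, so convergence is read off from that product tending to 1.\<close>

lemma sums_ln_zeta:
  assumes "1 < s"
  shows "(\<lambda>p. if prime p then - ln (1 - real p powr - s) else 0) sums ln (zeta_sum s)"
proof -
  have pos: "0 < 1 - real p powr - s" if "prime p" for p
    using prime_powr_minus_less_1[OF that, of s] assms by simp
  have z: "0 < zeta_sum s" using zeta_sum_ge_1[OF assms] by simp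
  have "(\<lambda>N. ln (zeta_sum s) - ln (zeta_sum s * (\<Prod>p | prime p \<and> p \<le> N. 1 - real p powr - s)))
      \<longlonglongrightarrow> ln (zeta_sum s) - ln 1"
    by (intro tendsto_intros euler_product_zeta assms) auto
  also have "(\<lambda>N. ln (zeta_sum s) - ln (zeta_sum s * (\<Prod>p | prime p \<and> p \<le> N. 1 - real p powr - s))) =
      (\<lambda>N. \<Sum>p\<le>N. if prime p then - ln (1 - real p powr - s) else 0)"
  proof
    fix N
    have "0 < (\<Prod>p | prime p \<and> p \<le> N. 1 - real p powr - s)"
      by (intro prod_pos) (use pos in auto)
    then have "ln (zeta_sum s) - ln (zeta_sum s * (\<Prod>p | prime p \<and> p \<le> N. 1 - real p powr - s))
        = - ln (\<Prod>p | prime p \<and> p \<le> N. 1 - real p powr - s)"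
      using z by (simp add: ln_mult_pos)
    also have "\<dots> = (\<Sum>p | prime p \<and> p \<le> N. - ln (1 - real p powr - s))"
      using pos by (subst ln_prod) (auto simp: sum_negf less_imp_neq)
    also have "\<dots> = (\<Sum>p\<le>N. if prime p then - ln (1 - real p powr - s) else 0)"
      by (intro sum.mono_neutral_cong_left) auto
    finally show "ln (zeta_sum s) - ln (zeta_sum s * (\<Prod>p | prime p \<and> p \<le> N. 1 - real p powr - s)) =
      (\<Sum>p\<le>N. if prime p then - ln (1 - real p powr - s) else 0)" .
  qed
  finally show ?thesis by (simp add: sums_def_le)
qed

section \<open>The zeta function near its pole at 1\<close>

text \<open>Integral comparison on a unit interval: the middle expression is the increment of an
  antiderivative of \<open>z powr - (1 + \<delta>)\<close>, and the mean value theorem evaluates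
  this decreasing function inside the interval.\<close>

lemma powr_diff_bounds:
  fixes x \<delta> :: real
  assumes "0 < x" "0 < \<delta>"
  shows "(x + 1) powr - (1 + \<delta>) \<le> x powr - \<delta> / \<delta> - (x + 1) powr - \<delta> / \<delta>"
    and "x powr - \<delta> / \<delta> - (x + 1) powr - \<delta> / \<delta> \<le> x powr - (1 + \<delta>)"
proof -
  have "\<exists>z>x. z < x + 1 \<and> (- ((x + 1) powr - \<delta>) / \<delta>) - (- (x powr - \<delta>) / \<delta>) = (x + 1 - x) * z powr - (1 + \<delta>)"
  proof (rule MVT2)
    fix z assume "x \<le> z"
    then have "((\<lambda>z. - (z powr - \<delta>) / \<delta>) has_real_derivative - (- \<delta> * z powr (- \<delta> - 1)) / \<delta>) (at z)"
      using assms by (auto intro!: derivative_eq_intros)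
    then show "((\<lambda>z. - (z powr - \<delta>) / \<delta>) has_real_derivative z powr - (1 + \<delta>)) (at z)"
      using assms by (simp add: minus_diff_commute)
  qed simp
  then obtain z where z: "x < z" "z < x + 1"
    "x powr - \<delta> / \<delta> - (x + 1) powr - \<delta> / \<delta> = z powr - (1 + \<delta>)" by auto
  show "(x + 1) powr - (1 + \<delta>) \<le> x powr - \<delta> / \<delta> - (x + 1) powr - \<delta> / \<delta>"
    "x powr - \<delta> / \<delta> - (x + 1) powr - \<delta> / \<delta> \<le> x powr - (1 + \<delta>)"
    unfolding z(3) using z(1,2) assms by (auto intro!: powr_mono2')
qed

lemma zeta_sum_bounds:
  assumes "0 < \<delta>"
  shows "1 / \<delta> \<le> zeta_sum (1 + \<delta>)" "zeta_sum (1 + \<delta>) \<le> 1 + 1 / \<delta>"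
proof -
  have s: "(\<lambda>n. real n powr - (1 + \<delta>)) sums zeta_sum (1 + \<delta>)"
    unfolding zeta_sum_def using assms by (intro summable_sums summable_zeta) simp
  then have s1: "(\<lambda>n. real (Suc n) powr - (1 + \<delta>)) sums zeta_sum (1 + \<delta>)"
    using sums_Suc_iff[of "\<lambda>n. real n powr - (1 + \<delta>)" "zeta_sum (1 + \<delta>)"] by simp
  then have s2: "(\<lambda>n. real (Suc (Suc n)) powr - (1 + \<delta>)) sums (zeta_sum (1 + \<delta>) - 1)"
    using sums_Suc_iff[of "\<lambda>n. real (Suc n) powr - (1 + \<delta>)" "zeta_sum (1 + \<delta>) - 1"] by simp
  \<comment> \<open>The telescoping series is the integral of \<open>z powr - (1 + \<delta>)\<close>
    over [1, \<infinity>), with value 1/\<delta>. Left endpoints bound it above by the zeta series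
    from n = 1, right endpoints bound it below by the series from n = 2.\<close>
  have "(\<lambda>n. real (Suc n) powr - \<delta> / \<delta>) \<longlonglongrightarrow> 0" using assms by real_asymp
  from telescope_sums'[OF this]
  have t: "(\<lambda>n. real (Suc n) powr - \<delta> / \<delta> - real (Suc (Suc n)) powr - \<delta> / \<delta>) sums (1 / \<delta>)" by simp
  show "1 / \<delta> \<le> zeta_sum (1 + \<delta>)"
    using powr_diff_bounds(2)[of "real (Suc _)" \<delta>] assms
    by (intro sums_le[OF _ t s1]) (simp add: add_ac)
  have "zeta_sum (1 + \<delta>) - 1 \<le> 1 / \<delta>"
    using powr_diff_bounds(1)[of "real (Suc _)" \<delta>] assms
    by (intro sums_le[OF _ s2 t]) (simp add: add_ac)
  then show "zeta_sum (1 + \<delta>) \<le> 1 + 1 / \<delta>" by simp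
qed

lemma ln_zeta_sum_asymp: "((\<lambda>\<delta>. ln (zeta_sum (1 + \<delta>)) + ln \<delta>) \<longlongrightarrow> 0) (at_right 0)"
proof (rule tendsto_sandwich)
  show "\<forall>\<^sub>F \<delta> in at_right 0. 0 \<le> ln (zeta_sum (1 + \<delta>)) + ln \<delta>"
    using eventually_at_right_less[of 0]
  proof eventually_elim
    case (elim \<delta>)
    then have "ln (1 / \<delta>) \<le> ln (zeta_sum (1 + \<delta>))"
      using zeta_sum_bounds(1)[of \<delta>] by (intro ln_mono) auto
    then show ?case using elim by (simp add: ln_div)
  qed
  show "\<forall>\<^sub>F \<delta> in at_right 0. ln (zeta_sum (1 + \<delta>)) + ln \<delta> \<le> ln (1 + 1 / \<delta>) + ln \<delta>"
    using eventually_at_right_less[of 0]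
  proof eventually_elim
    case (elim \<delta>)
    then have "0 < 1 / \<delta>" by simp
    then have "ln (zeta_sum (1 + \<delta>)) \<le> ln (1 + 1 / \<delta>)"
      using zeta_sum_bounds[OF elim] by (intro ln_mono) linarith+
    then show ?case by simp
  qed
  show "((\<lambda>\<delta>::real. ln (1 + 1 / \<delta>) + ln \<delta>) \<longlongrightarrow> 0) (at_right 0)"
    by real_asymp
qed simp_all

section \<open>Mertens' third theorem\<close>

definition mertens_weight :: "nat \<Rightarrow> real" where
  "mertens_weight n = (if prime n then - ln (1 - 1 / real n) else 0)"

lemma minus_ln_one_minus_bounds:
  fixes x :: real
  assumes "0 \<le> x" "x < 1"
  shows "x \<le> - ln (1 - x)" "- ln (1 - x) \<le> x / (1 - x)"
proof -
  show "x \<le> - ln (1 - x)"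
    using ln_one_minus_pos_upper_bound[OF assms] by simp
  have "- ln (1 - x) = ln (1 + x / (1 - x))"
    using assms by (simp add: ln_div field_simps)
  also have "\<dots> \<le> x / (1 - x)"
    using assms by (intro ln_add_one_self_le_self) auto
  finally show "- ln (1 - x) \<le> x / (1 - x)" .
qed

text \<open>For x = 1/p and z = p^(-\<delta>) this compares the weighted Mertens term with the
  logarithm of the Euler factor at 1 + \<delta>. The bound is independent of z, hence uniform in
  \<delta>, and summable over p.\<close>

lemma abs_mult_ln_one_minus_le:
  fixes x z :: real
  assumes "0 \<le> x" "x \<le> 1 / 2" "0 \<le> z" "z \<le> 1"
  shows "\<bar>- ln (1 - x) * z + ln (1 - x * z)\<bar> \<le> 2 * x\<^sup>2"
proof -
  have xz: "0 \<le> x * z" "x * z \<le> x" using assms by (auto simp: mult_left_le)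
  have 1: "y / (1 - y) \<le> y + 2 * y\<^sup>2" if "0 \<le> y" "y \<le> 1/2" for y :: real
  proof -
    have "0 \<le> y\<^sup>2 * (1 - 2 * y)" using that by simp
    then show ?thesis using that by (simp add: field_simps power2_eq_square)
  qed
  have "- ln (1 - x) * z \<le> (x + 2 * x\<^sup>2) * z"
    using minus_ln_one_minus_bounds(2)[of x] 1[of x] assms by (intro mult_right_mono) auto
  moreover have "2 * x\<^sup>2 * z \<le> 2 * x\<^sup>2" using assms by (intro mult_left_le) auto
  moreover have "x * z \<le> - ln (1 - x) * z"
    using minus_ln_one_minus_bounds(1)[of x] assms by (intro mult_right_mono) auto
  moreover have "x * z \<le> - ln (1 - x * z)" "- ln (1 - x * z) \<le> x * z + 2 * (x * z)\<^sup>2"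
    using minus_ln_one_minus_bounds[of "x * z"] 1[of "x * z"] assms xz by auto
  moreover have "(x * z)\<^sup>2 \<le> x\<^sup>2" using xz by (intro power_mono) auto
  ultimately show ?thesis unfolding abs_le_iff by (auto simp: algebra_simps)
qed

lemma mertens_weight_nonneg: "0 \<le> mertens_weight n"
  using minus_ln_one_minus_bounds(1)[of "1 / real n"] prime_gt_1_nat[of n]
  by (auto simp: mertens_weight_def intro: order_trans[of _ "1 / real n"])

text \<open>The transform differs from ln zeta(1 + \<delta>) by a series G that converges uniformly
  for \<delta> \<ge> 0. So G is continuous, and every term vanishes at \<delta> = 0, where
  p^(-\<delta>) = 1.\<close>

lemma laplace_mertens_weight:
  shows "0 < \<delta> \<Longrightarrow> summable (\<lambda>n. mertens_weight n * exp (- \<delta> * ln (real n)))"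
    and "((\<lambda>\<delta>. laplace_sum mertens_weight (\<lambda>n. ln (real n)) \<delta> + ln \<delta>) \<longlongrightarrow> 0) (at_right 0)"
proof -
  define g where "g p \<delta> = (if prime p then - ln (1 - 1 / real p) * real p powr - \<delta> +
      ln (1 - 1 / real p * real p powr - \<delta>) else 0)" for p :: nat and \<delta> :: real
  define G where "G \<delta> = (\<Sum>p. g p \<delta>)" for \<delta>
  have bound: "norm (g p \<delta>) \<le> 2 * inverse (real p ^ 2)" if "\<delta> \<in> {0..}" for p \<delta>
  proof (cases "prime p")
    case True
    then have "2 \<le> real p" using prime_ge_2_nat by (simp add: numeral_le_real_of_nat_iff)
    moreover have "real p powr - \<delta> \<le> real p powr 0"
      using that calculation by (intro powr_mono) auto
    ultimately have "\<bar>- ln (1 - 1 / real p) * real p powr - \<delta> + ln (1 - 1 / real p * real p powr - \<delta>)\<bar>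
        \<le> 2 * (1 / real p)\<^sup>2"
      by (intro abs_mult_ln_one_minus_le) (auto simp: field_simps)
    then show ?thesis using True by (simp add: g_def power_divide inverse_eq_divide)
  qed (simp add: g_def)
  have M: "summable (\<lambda>p. 2 * inverse (real p ^ 2))"
    by (intro summable_mult inverse_power_summable) simp
  have g_summable: "summable (\<lambda>p. g p \<delta>)" if "0 \<le> \<delta>" for \<delta>
    using that bound[of \<delta>] by (intro summable_comparison_test'[OF M, of 0]) auto
  have ul: "uniform_limit {0..} (\<lambda>n \<delta>. \<Sum>p<n. g p \<delta>) G sequentially"
    unfolding G_def by (rule Weierstrass_m_test[OF bound M])
  have "continuous_on {0..} (\<lambda>\<delta>. g p \<delta>)" for p
  proof (cases "prime p")
    case True
    then have p: "1 < real p" using prime_gt_1_nat[of p] by simp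
    have "1 / real p * real p powr - \<delta> \<noteq> 1" if "0 \<le> \<delta>" for \<delta>
    proof -
      have "real p powr - \<delta> \<le> real p powr 0" using that p by (intro powr_mono) auto
      then show ?thesis using p by (simp add: field_simps)
    qed
    then show ?thesis using True p unfolding g_def
      by (auto intro!: continuous_intros)
  qed (simp add: g_def)
  then have "continuous_on {0..} (\<lambda>\<delta>. \<Sum>p<n. g p \<delta>)" for n by (intro continuous_on_sum)
  then have "continuous_on {0..} G"
    by (intro uniform_limit_theorem[OF _ ul] always_eventually allI sequentially_bot)
  then have "(G \<longlongrightarrow> G 0) (at 0 within {0..})"
    by (simp add: continuous_on_def)
  moreover have "G 0 = 0"
    unfolding G_def g_def by (simp add: prime_gt_0_nat cong: if_cong)
  ultimately have G: "(G \<longlongrightarrow> 0) (at_right 0)"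
    by (auto elim!: tendsto_within_subset)
  have main: "(\<lambda>n. mertens_weight n * exp (- \<delta> * ln (real n))) sums (G \<delta> + ln (zeta_sum (1 + \<delta>)))"
    if "0 < \<delta>" for \<delta>
  proof -
    have "(\<lambda>p. g p \<delta> + (if prime p then - ln (1 - real p powr - (1 + \<delta>)) else 0))
      sums (G \<delta> + ln (zeta_sum (1 + \<delta>)))"
      unfolding G_def using that by (intro sums_add summable_sums g_summable sums_ln_zeta) auto
    also have "(\<lambda>p. g p \<delta> + (if prime p then - ln (1 - real p powr - (1 + \<delta>)) else 0)) =
        (\<lambda>n. mertens_weight n * exp (- \<delta> * ln (real n)))"
    proof
      fix p
      have "1 / real p * real p powr - \<delta> = real p powr - (1 + \<delta>)" if "prime p"
        using prime_gt_0_nat[OF that] by (simp add: powr_diff powr_minus field_simps powr_add)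
      then show "g p \<delta> + (if prime p then - ln (1 - real p powr - (1 + \<delta>)) else 0) =
          mertens_weight p * exp (- \<delta> * ln (real p))"
        using prime_gt_0_nat[of p] by (auto simp: g_def mertens_weight_def powr_def)
    qed
    finally show ?thesis .
  qed
  show "0 < \<delta> \<Longrightarrow> summable (\<lambda>n. mertens_weight n * exp (- \<delta> * ln (real n)))"
    using main sums_summable by blast
  have "((\<lambda>\<delta>. G \<delta> + (ln (zeta_sum (1 + \<delta>)) + ln \<delta>)) \<longlongrightarrow> 0) (at_right 0)"
    using tendsto_add[OF G ln_zeta_sum_asymp] by simp
  moreover have "\<forall>\<^sub>F \<delta> in at_right 0. G \<delta> + (ln (zeta_sum (1 + \<delta>)) + ln \<delta>) =
      laplace_sum mertens_weight (\<lambda>n. ln (real n)) \<delta> + ln \<delta>"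
    using eventually_at_right_less[of 0]
    by eventually_elim (use main in \<open>simp add: laplace_sum_def sums_iff\<close>)
  ultimately show "((\<lambda>\<delta>. laplace_sum mertens_weight (\<lambda>n. ln (real n)) \<delta> + ln \<delta>) \<longlongrightarrow> 0) (at_right 0)"
    by (rule Lim_transform_eventually)
qed

lemma laplace_harmonic:
  shows "0 < \<delta> \<Longrightarrow> summable (\<lambda>n. 1 / real n * exp (- \<delta> * real n))"
    and "((\<lambda>\<delta>. laplace_sum (\<lambda>n. 1 / real n) real \<delta> + ln \<delta>) \<longlongrightarrow> 0) (at_right 0)"
proof -
  \<comment> \<open>The series of ln (1 + x) at x = - exp (- \<delta>); its term of index 0 is zero
    because \<open>1 / real 0 = 0\<close>.\<close>
  have main: "(\<lambda>n. 1 / real n * exp (- \<delta> * real n)) sums (- ln (1 - exp (- \<delta>)))" if "0 < \<delta>" for \<delta>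
    using sums_minus[OF ln_series'[of "- exp (- \<delta>)"]] that
    by (simp add: mult.commute flip: exp_of_nat_mult)
  show "0 < \<delta> \<Longrightarrow> summable (\<lambda>n. 1 / real n * exp (- \<delta> * real n))"
    using main sums_summable by blast
  have "((\<lambda>\<delta>::real. - ln (1 - exp (- \<delta>)) + ln \<delta>) \<longlongrightarrow> 0) (at_right 0)" by real_asymp
  moreover have "\<forall>\<^sub>F \<delta> in at_right 0. - ln (1 - exp (- \<delta>)) + ln \<delta> =
      laplace_sum (\<lambda>n. 1 / real n) real \<delta> + ln \<delta>"
    using eventually_at_right_less[of 0]
    by eventually_elim (use main in \<open>simp add: laplace_sum_def sums_iff\<close>)
  ultimately show "((\<lambda>\<delta>. laplace_sum (\<lambda>n. 1 / real n) real \<delta> + ln \<delta>) \<longlongrightarrow> 0) (at_right 0)"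
    by (rule Lim_transform_eventually)
qed

lemma harm_floor_minus_ln: "((\<lambda>u. harm (nat \<lfloor>u\<rfloor>) - ln u) \<longlongrightarrow> euler_mascheroni) (at_top :: real filter)"
proof -
  have "filterlim (\<lambda>u::real. nat \<lfloor>u\<rfloor>) sequentially at_top"
    by (rule filterlim_compose[OF filterlim_nat_sequentially filterlim_floor_sequentially])
  from filterlim_compose[OF euler_mascheroni_LIMSEQ this]
  have "((\<lambda>u::real. harm (nat \<lfloor>u\<rfloor>) - ln (real (nat \<lfloor>u\<rfloor>))) \<longlongrightarrow> euler_mascheroni) at_top" .
  moreover have "((\<lambda>u::real. ln (of_int \<lfloor>u\<rfloor>) - ln u) \<longlongrightarrow> 0) at_top" by real_asymp
  ultimately have "((\<lambda>u::real. (harm (nat \<lfloor>u\<rfloor>) - ln (real (nat \<lfloor>u\<rfloor>))) + (ln (of_int \<lfloor>u\<rfloor>) - ln u))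
    \<longlongrightarrow> euler_mascheroni) at_top" using tendsto_add by fastforce
  moreover have "\<forall>\<^sub>F u::real in at_top. (harm (nat \<lfloor>u\<rfloor>) - ln (real (nat \<lfloor>u\<rfloor>))) + (ln (of_int \<lfloor>u\<rfloor>) - ln u)
    = harm (nat \<lfloor>u\<rfloor>) - ln u"
    using eventually_ge_at_top[of 0] by eventually_elim (simp add: of_nat_nat)
  ultimately show ?thesis by (rule Lim_transform_eventually)
qed

text \<open>Supplies the common limit l = ln 2 that the Tauberian comparison asks of both
  measures.\<close>

lemma laplace_doubling:
  fixes L :: "real \<Rightarrow> real"
  assumes "((\<lambda>\<delta>. L \<delta> + ln \<delta>) \<longlongrightarrow> 0) (at_right 0)"
  shows "((\<lambda>\<delta>. L \<delta> - L (2 * \<delta>)) \<longlongrightarrow> ln 2) (at_right 0)"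
proof -
  have "((\<lambda>\<delta>. (L \<delta> + ln \<delta>) - (L (2 * \<delta>) + ln (2 * \<delta>)) + ln 2) \<longlongrightarrow> ln 2) (at_right 0)"
    by (rule tendsto_eq_rhs[of _ "0 - 0 + ln 2"], intro tendsto_intros assms filterlim_compose[OF assms] filterlim_mult_at_right_0) simp_all
  moreover have "\<forall>\<^sub>F \<delta> in at_right 0. (L \<delta> + ln \<delta>) - (L (2 * \<delta>) + ln (2 * \<delta>)) + ln 2 = L \<delta> - L (2 * \<delta>)"
    using eventually_at_right_less[of 0] by eventually_elim (simp add: ln_mult_pos)
  ultimately show ?thesis by (rule Lim_transform_eventually)
qed

theorem mertens_third_log:
  "((\<lambda>x. (\<Sum>p | prime p \<and> real p \<le> x. - ln (1 - 1 / real p)) - ln (ln x)) \<longlongrightarrow> euler_mascheroni) at_top"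
proof -
  let ?L1 = "laplace_sum mertens_weight (\<lambda>n. ln (real n))"
  let ?L2 = "laplace_sum (\<lambda>n. 1 / real n) real"
  define M where "M u = (\<Sum>n. mertens_weight n * of_bool (ln (real n) \<le> u))" for u
  define H where "H u = (\<Sum>n. 1 / real n * of_bool (real n \<le> u))" for u
  have "((\<lambda>\<delta>. (?L1 \<delta> + ln \<delta>) - (?L2 \<delta> + ln \<delta>)) \<longlongrightarrow> 0 - 0) (at_right 0)"
    by (intro tendsto_diff laplace_mertens_weight laplace_harmonic)
  then have d12: "((\<lambda>\<delta>. ?L1 \<delta> - ?L2 \<delta>) \<longlongrightarrow> 0) (at_right 0)" by simp
  then have d21: "((\<lambda>\<delta>. ?L2 \<delta> - ?L1 \<delta>) \<longlongrightarrow> 0) (at_right 0)"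
    using tendsto_minus[OF d12] by simp
  have lnn: "0 \<le> ln (real n)" for n by (cases "n = 0") auto
  have MH: "\<forall>\<^sub>F u in at_top. M u \<le> H (c * u) + \<epsilon>" if "1 < c" "0 < \<epsilon>" for c \<epsilon>
    unfolding M_def H_def
    by (rule laplace_tauberian_le[where l = "ln 2", OF mertens_weight_nonneg _ lnn _ laplace_mertens_weight(1)
        laplace_harmonic(1) d12 laplace_doubling[OF laplace_mertens_weight(2)] laplace_doubling[OF laplace_harmonic(2)] that])
      auto
  have HM: "\<forall>\<^sub>F u in at_top. H u \<le> M (c * u) + \<epsilon>" if "1 < c" "0 < \<epsilon>" for c \<epsilon>
    unfolding M_def H_def
    by (rule laplace_tauberian_le[where l = "ln 2", OF _ mertens_weight_nonneg _ lnn laplace_harmonic(1)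
        laplace_mertens_weight(1) d21 laplace_doubling[OF laplace_harmonic(2)] laplace_doubling[OF laplace_mertens_weight(2)] that])
      auto
  have H_eq: "H u = harm (nat \<lfloor>u\<rfloor>)" if "0 \<le> u" for u
  proof -
    have "H u = (\<Sum>n\<in>{1..nat \<lfloor>u\<rfloor>}. 1 / real n * of_bool (real n \<le> u))"
      unfolding H_def by (intro suminf_finite) (auto simp: not_less_eq_eq dest: le_nat_floor)
    also have "\<dots> = harm (nat \<lfloor>u\<rfloor>)"
      unfolding harm_def using that by (intro sum.cong) (auto simp: inverse_eq_divide le_nat_iff le_floor_iff)
    finally show ?thesis .
  qed
  have H: "((\<lambda>u. H u - ln u) \<longlongrightarrow> euler_mascheroni) at_top"
    using harm_floor_minus_ln by (rule Lim_transform_eventually)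
      (use eventually_ge_at_top[of 0] in eventually_elim, simp add: H_eq)
  have "((\<lambda>u. M u - ln u) \<longlongrightarrow> euler_mascheroni) at_top"
  proof (rule tendstoI)
    fix e :: real assume "0 < e"
    \<comment> \<open>Three losses of \<epsilon> add up: the Tauberian error, the shift ln c for the
      dilation c = exp \<epsilon>, and the distance of H u - ln u from \<gamma>. For the lower bound
      the comparison is applied at exp (- \<epsilon>) u, so that M is evaluated at u itself.\<close>
    define \<epsilon> where "\<epsilon> = e / 3"
    have \<epsilon>: "0 < \<epsilon>" "1 < exp \<epsilon>" using \<open>0 < e\<close> by (simp_all add: \<epsilon>_def)
    have up: "\<forall>\<^sub>F u in at_top. H u - ln u < euler_mascheroni + \<epsilon>"
      and lo: "\<forall>\<^sub>F u in at_top. euler_mascheroni - \<epsilon> < H u - ln u"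
      using order_tendstoD[OF H] \<epsilon> by auto
    have f1: "filterlim (\<lambda>u. exp \<epsilon> * u) at_top at_top" and f2: "filterlim (\<lambda>u. exp (- \<epsilon>) * u) at_top at_top"
      by (auto intro: filterlim_tendsto_pos_mult_at_top[OF tendsto_const _ filterlim_ident])
    show "\<forall>\<^sub>F u in at_top. dist (M u - ln u) euler_mascheroni < e"
      using MH[OF \<epsilon>(2,1)] eventually_compose_filterlim[OF HM[OF \<epsilon>(2,1)] f2]
        eventually_compose_filterlim[OF up f1] eventually_compose_filterlim[OF lo f2] eventually_gt_at_top[of 0]
    proof eventually_elim
      case (elim u)
      have 1: "exp \<epsilon> * (exp (- \<epsilon>) * u) = u" by (simp flip: mult.assoc exp_add)
      have 2: "ln (exp \<epsilon> * u) = \<epsilon> + ln u" "ln (exp (- \<epsilon>) * u) = - \<epsilon> + ln u"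
        using elim by (simp_all add: ln_mult_pos)
      have "e = 3 * \<epsilon>" by (simp add: \<epsilon>_def)
      with elim show ?case unfolding 1 2 dist_real_def abs_less_iff by (intro conjI; linarith)
    qed
  qed
  from filterlim_compose[OF this ln_at_top]
  have "((\<lambda>x. M (ln x) - ln (ln x)) \<longlongrightarrow> euler_mascheroni) at_top" .
  moreover have "\<forall>\<^sub>F x in at_top. M (ln x) - ln (ln x) =
      (\<Sum>p | prime p \<and> real p \<le> x. - ln (1 - 1 / real p)) - ln (ln x)"
    using eventually_gt_at_top[of 0]
  proof eventually_elim
    case (elim x)
    have fin: "finite {p::nat. prime p \<and> real p \<le> x}"
      by (rule finite_subset[of _ "{..nat \<lfloor>x\<rfloor>}"]) (auto simp: le_nat_floor)
    have "M (ln x) = (\<Sum>p | prime p \<and> real p \<le> x. mertens_weight p * of_bool (ln (real p) \<le> ln x))"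
      unfolding M_def using elim
      by (intro suminf_finite fin) (auto simp: mertens_weight_def prime_gt_0_nat)
    also have "\<dots> = (\<Sum>p | prime p \<and> real p \<le> x. - ln (1 - 1 / real p))"
      using elim by (intro sum.cong) (auto simp: mertens_weight_def prime_gt_0_nat)
    finally show ?case by simp
  qed
  ultimately show ?thesis by (rule Lim_transform_eventually)
qed

section \<open>Numerical bounds\<close>

lemma suminf_le_telescope:
  fixes f h :: "nat \<Rightarrow> real"
  assumes "f sums S" "h \<longlonglongrightarrow> 0" "\<And>n. N \<le> n \<Longrightarrow> f n \<le> h n - h (Suc n)"
  shows "S \<le> (\<Sum>n<N. f n) + h N"
proof -
  have f: "(\<lambda>n. f (n + N)) sums (S - (\<Sum>n<N. f n))"
    using assms(1) by (rule sums_split_initial_segment)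
  have "(\<lambda>n. h (n + N) - h (Suc n + N)) sums (h (0 + N) - 0)"
    by (rule telescope_sums'[OF LIMSEQ_ignore_initial_segment[OF assms(2)]])
  then have "S - (\<Sum>n<N. f n) \<le> h (0 + N) - 0"
    using assms(3) by (intro sums_le[OF _ f]) auto
  then show ?thesis by simp
qed

lemma suminf_ge_telescope:
  fixes f h :: "nat \<Rightarrow> real"
  assumes "f sums S" "h \<longlonglongrightarrow> 0" "\<And>n. N \<le> n \<Longrightarrow> h n - h (Suc n) \<le> f n"
  shows "(\<Sum>n<N. f n) + h N \<le> S"
  using suminf_le_telescope[OF sums_minus[OF assms(1)] tendsto_minus[OF assms(2), simplified], of N] assms(3)
  by (simp add: sum_negf) (smt (verit, best))

lemma sums_zeta_nat:
  assumes "2 \<le> k"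
  shows "(\<lambda>n. 1 / real n ^ k) sums zeta_sum (real k)"
proof -
  have "(\<lambda>n. real n powr - real k) sums zeta_sum (real k)"
    unfolding zeta_sum_def using assms by (intro summable_sums summable_zeta) simp
  also have "(\<lambda>n. real n powr - real k) = (\<lambda>n. 1 / real n ^ k)"
  proof
    fix n show "real n powr - real k = 1 / real n ^ k"
      using assms by (cases "n = 0") (auto simp: powr_minus powr_realpow divide_inverse power_0_left)
  qed
  finally show ?thesis .
qed

lemma zeta_2: "zeta_sum 2 = pi\<^sup>2 / 6"
proof -
  have "(\<lambda>n. 1 / real (Suc n) ^ 2) sums (pi\<^sup>2 / 6)"
    using inverse_squares_sums by (simp add: add_ac)
  then have "(\<lambda>n. 1 / real n ^ 2) sums (pi\<^sup>2 / 6)"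
    using sums_Suc_iff[of "\<lambda>n. 1 / real n ^ 2" "pi\<^sup>2 / 6"] by simp
  with sums_zeta_nat[of 2] show ?thesis by (simp add: sums_iff)
qed

lemma zeta_3_bounds: "1.2020568 \<le> zeta_sum 3" "zeta_sum 3 \<le> 1.202057"
proof -
  \<comment> \<open>h c n - h c (n + 1) = n / (n^4 + (2 c - 1) n^2 + c^2) is below 1 / n^3 for c = 1/2 and above it
    for slightly smaller c and large n.\<close>
  define h where "h c n = (1 / 2) / (real n * (real n - 1) + c)" for c :: real and n :: nat
  have lim: "h c \<longlonglongrightarrow> 0" for c unfolding h_def by real_asymp
  have diff: "h c n - h c (Suc n) = real n / ((real n)^4 + (2 * c - 1) * (real n)\<^sup>2 + c\<^sup>2)"
    if "0 < c" "12 \<le> n" for c n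
  proof -
    have "0 < real n * (real n - 1)" using that by simp
    then have "real n * (real n - 1) + c \<noteq> 0" "(real n + 1) * real n + c \<noteq> 0"
      using that by (smt (verit, best) mult_nonneg_nonneg of_nat_0_le_iff)+
    moreover have "(real n)^4 + (2 * c - 1) * (real n)\<^sup>2 + c\<^sup>2 =
        (real n * (real n - 1) + c) * ((real n + 1) * real n + c)"
      by (simp add: algebra_simps power2_eq_square power4_eq_xxxx)
    ultimately show ?thesis unfolding h_def by (simp add: add_ac divide_simps) (simp add: algebra_simps)
  qed
  have s: "(\<lambda>n. 1 / real n ^ 3) sums zeta_sum 3" using sums_zeta_nat[of 3] by simp
  have "(\<Sum>n<12. 1 / real n ^ 3) + h (1/2) 12 \<le> zeta_sum 3"
  proof (rule suminf_ge_telescope[OF s lim])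
    fix n :: nat assume n: "12 \<le> n"
    have "h (1/2) n - h (1/2) (Suc n) = real n / ((real n)^4 + 1/4)"
      using n by (subst diff) (simp_all add: power2_eq_square)
    also have "\<dots> \<le> real n / (real n)^4" using n by (intro divide_left_mono mult_pos_pos add_pos_pos) auto
    also have "\<dots> = 1 / real n ^ 3" using n by (simp add: eval_nat_numeral)
    finally show "h (1/2) n - h (1/2) (Suc n) \<le> 1 / real n ^ 3" .
  qed
  moreover have "1.2020568 \<le> (\<Sum>n<12. 1 / real n ^ 3) + h (1/2) 12"
    by (simp add: eval_nat_numeral h_def)
  ultimately show "1.2020568 \<le> zeta_sum 3" by linarith
  have "zeta_sum 3 \<le> (\<Sum>n<12. 1 / real n ^ 3) + h 0.499 12"
  proof (rule suminf_le_telescope[OF s lim])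
    fix n :: nat assume n: "12 \<le> n"
    \<comment> \<open>For c = 0.499 the denominator drops below n^4 as soon as 0.002 n^2 \<ge>
      0.249001, which first holds at n = 12.\<close>
    have "144 \<le> (real n)\<^sup>2" using n power_mono[of 12 "real n" 2] by simp
    then have *: "(2 * 0.499 - 1) * (real n)\<^sup>2 + 0.499\<^sup>2 \<le> 0" by (simp add: power2_eq_square)
    have pos: "0 < (real n)^4 + ((2 * 0.499 - 1) * (real n)\<^sup>2 + 0.499\<^sup>2)"
    proof -
      have "(real n)\<^sup>2 \<le> (real n)^4" using n by (intro power_increasing) auto
      moreover have "0 < (real n)\<^sup>2" using n by simp
      ultimately show ?thesis by (simp add: power2_eq_square)
    qed
    have "1 / real n ^ 3 = real n / (real n)^4" using n by (simp add: eval_nat_numeral)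
    also have "\<dots> \<le> real n / ((real n)^4 + ((2 * 0.499 - 1) * (real n)\<^sup>2 + 0.499\<^sup>2))"
      using n * pos by (intro divide_left_mono mult_pos_pos) auto
    also have "\<dots> = h 0.499 n - h 0.499 (Suc n)" using n by (subst diff) (auto simp: add.assoc)
    finally show "1 / real n ^ 3 \<le> h 0.499 n - h 0.499 (Suc n)" .
  qed
  moreover have "(\<Sum>n<12. 1 / real n ^ 3) + h 0.499 12 \<le> 1.202057"
    by (simp add: eval_nat_numeral h_def)
  ultimately show "zeta_sum 3 \<le> 1.202057" by linarith
qed

lemma zeta_6_bounds: "1.0173429 \<le> zeta_sum 6" "zeta_sum 6 \<le> 1.0173434"
proof -
  have s: "(\<lambda>n. 1 / real n ^ 6) sums zeta_sum 6" using sums_zeta_nat[of 6] by simp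
  have "(\<Sum>n<20. 1 / real n ^ 6) \<le> zeta_sum 6"
    using s by (intro sum_le_suminf[of "\<lambda>n. 1 / real n ^ 6" "{..<20}", simplified sums_unique[OF s, symmetric]]) (auto simp: sums_iff)
  moreover have "1.0173429 \<le> (\<Sum>n<20. 1 / real n ^ 6)"
    by (simp add: eval_nat_numeral)
  ultimately show "1.0173429 \<le> zeta_sum 6" by linarith
  \<comment> \<open>Four of the six factors n are replaced by 20; the remaining 1 / (n (n - 1))
    telescopes.\<close>
  define h where "h n = 1 / (20 ^ 4 * (real n - 1))" for n :: nat
  have "h \<longlonglongrightarrow> 0" unfolding h_def by real_asymp
  then have "zeta_sum 6 \<le> (\<Sum>n<20. 1 / real n ^ 6) + h 20"
  proof (rule suminf_le_telescope[OF s])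
    fix n :: nat assume n: "20 \<le> n"
    have "1 / real n ^ 6 = 1 / (real n ^ 4 * (real n * real n))" by (simp add: eval_nat_numeral mult_ac)
    also have "\<dots> \<le> 1 / (20 ^ 4 * (real n * (real n - 1)))"
      using n by (intro divide_left_mono mult_mono power_mono mult_pos_pos) auto
    also have "\<dots> = h n - h (Suc n)" using n by (simp add: h_def field_simps)
    finally show "1 / real n ^ 6 \<le> h n - h (Suc n)" .
  qed
  moreover have "(\<Sum>n<20. 1 / real n ^ 6) + h 20 \<le> 1.0173434"
    by (simp add: eval_nat_numeral h_def)
  ultimately show "zeta_sum 6 \<le> 1.0173434" by linarith
qed

section \<open>Two-sided bounds for Euler's constant\<close>

text \<open>Half the logarithm already contains the term 1/(2n) in the expansion of harm n - ln n,
  and c is free to adjust the next one: c = 1/3 reproduces -1/(12 n^2). This is why n = 20 gives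
  enough digits.\<close>

lemma harm_minus_half_ln_LIMSEQ:
  fixes c :: real
  shows "(\<lambda>n. harm n - ln ((real n)\<^sup>2 + real n + c) / 2) \<longlonglongrightarrow> euler_mascheroni"
proof -
  have "(\<lambda>n. ln (real n) - ln ((real n)\<^sup>2 + real n + c) / 2) \<longlonglongrightarrow> 0" by real_asymp
  from tendsto_add[OF euler_mascheroni_LIMSEQ this] show ?thesis by (simp add: algebra_simps)
qed

text \<open>The two arguments are (n^2 + c) + n and (n^2 + c) - n, so the increment is artanh y. It
  is enclosed by two terms of its series and a geometric bound for the rest.\<close>

lemma half_ln_step:
  fixes n c :: real
  assumes "1 \<le> n" "0 < c"
  defines "y \<equiv> n / (n\<^sup>2 + c)"
  shows "ln (n\<^sup>2 + n + c) / 2 - ln ((n - 1)\<^sup>2 + (n - 1) + c) / 2 \<in> {y + y^3/3 .. y + y^3/3 + y^5 / (5 * (1 - y\<^sup>2))}"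
proof -
  define x where "x = (n\<^sup>2 + n + c) / (n\<^sup>2 - n + c)"
  have "n * 1 \<le> n\<^sup>2" unfolding power2_eq_square using assms by (intro mult_left_mono) auto
  then have pos: "0 < n\<^sup>2 - n + c" "0 < n\<^sup>2 + n + c" "0 < n\<^sup>2 + c"
    using assms(1,2) by linarith+
  have x: "1 < x" using pos assms by (simp add: x_def)
  have y: "(x - 1) / (x + 1) = y"
    using pos unfolding x_def y_def by (simp add: divide_simps)
  have "ln x = ln (n\<^sup>2 + n + c) - ln ((n - 1)\<^sup>2 + (n - 1) + c)"
    using pos unfolding x_def by (simp add: ln_div power2_eq_square algebra_simps)
  then show ?thesis
    using ln_approx_bounds[OF x, of 2] unfolding y by (simp add: eval_nat_numeral field_simps)
qed

text \<open>
  \<open>harm n - ln (n\<^sup>2 + n + c) / 2\<close> tends to \<open>\<gamma>\<close> for every c. It is increasing for \<open>c = 1 / 3\<close>, where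
  the terms of order -3 in n of its increments cancel, and eventually decreasing for smaller c.
\<close>

lemma euler_mascheroni_ge: "harm 20 - ln (420 + 1/3) / 2 \<le> (euler_mascheroni :: real)"
proof -
  define v where "v n = harm n - ln ((real n)\<^sup>2 + real n + 1/3) / 2" for n
  have "v n \<le> v (Suc n)" for n
  proof -
    define m where "m = real (Suc n)"
    define y where "y = m / (m\<^sup>2 + 1/3)"
    have m: "1 \<le> m" "real n = m - 1" by (auto simp: m_def)
    have y: "y = 3 * m / (3 * m\<^sup>2 + 1)" using m by (simp add: y_def field_simps)
    have pos: "0 < 3 * m\<^sup>2 + 1" using m by (simp add: add_pos_pos)
    have m2: "m\<^sup>2 \<ge> 1" using m by simp
    \<comment> \<open>Expanding in q = m^2 - 1 \<ge> 0 gives the polynomials in m^2 below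
      nonnegative coefficients, which makes their signs evident.\<close>
    define q where "q = m\<^sup>2 - 1"
    have q: "m\<^sup>2 = 1 + q" "0 \<le> q" using m2 by (simp_all add: q_def)
    have pos2: "0 < 9 * m^4 - 3 * m\<^sup>2 + 1"
    proof -
      have "9 * m^4 - 3 * m\<^sup>2 + 1 = 9 * (m\<^sup>2)\<^sup>2 - 3 * m\<^sup>2 + 1" by simp
      then show ?thesis unfolding q(1) using q(2) by (simp add: power2_eq_square algebra_simps add_pos_nonneg)
    qed
    have y1: "1 - y\<^sup>2 = (9 * m^4 - 3 * m\<^sup>2 + 1) / (3 * m\<^sup>2 + 1)\<^sup>2"
      using pos unfolding y by (simp add: power_divide divide_simps) (simp add: algebra_simps eval_nat_numeral)
    \<comment> \<open>The gap as a single fraction: degree 6 over degree 11, so it has order m^(-5),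
      the order -3 having cancelled.\<close>
    have "1 / m - (y + y^3 / 3 + y^5 / (5 * (1 - y\<^sup>2))) =
      (27 * m^6 - 45 * m^4 + 15 * m\<^sup>2 + 5) / (5 * m * (3 * m\<^sup>2 + 1)^3 * (9 * m^4 - 3 * m\<^sup>2 + 1))"
    proof -
      have e: "y + y^3 / 3 + y^5 / (5 * (1 - y\<^sup>2)) = 3 * m / (3 * m\<^sup>2 + 1) + 9 * m^3 / (3 * m\<^sup>2 + 1)^3 +
        243 * m^5 / (5 * (3 * m\<^sup>2 + 1)^3 * (9 * m^4 - 3 * m\<^sup>2 + 1))"
        using pos pos2 unfolding y1 unfolding y by (simp add: power_divide power_mult_distrib divide_simps eval_nat_numeral)
      define A where "A = 3 * m\<^sup>2 + 1"
      define B where "B = 9 * m^4 - 3 * m\<^sup>2 + 1"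
      have AB: "A \<noteq> 0" "B \<noteq> 0" "m \<noteq> 0" using pos pos2 m by (auto simp: A_def B_def)
      have "1 / m - (3 * m / A + 9 * m^3 / A^3 + 243 * m^5 / (5 * A^3 * B)) =
        (5 * A^3 * B - 15 * m\<^sup>2 * A\<^sup>2 * B - 45 * m^4 * B - 243 * m^6) / (5 * m * A^3 * B)"
        using AB by (simp add: divide_simps eval_nat_numeral) (simp add: algebra_simps)
      also have "5 * A^3 * B - 15 * m\<^sup>2 * A\<^sup>2 * B - 45 * m^4 * B - 243 * m^6 = 27 * m^6 - 45 * m^4 + 15 * m\<^sup>2 + 5"
        unfolding A_def B_def by (simp add: eval_nat_numeral algebra_simps)
      finally show ?thesis unfolding e A_def B_def .
    qed
    moreover have "0 \<le> 27 * m^6 - 45 * m^4 + 15 * m\<^sup>2 + 5"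
    proof -
      have "27 * m^6 - 45 * m^4 + 15 * m\<^sup>2 + 5 = 27 * (m\<^sup>2)^3 - 45 * (m\<^sup>2)\<^sup>2 + 15 * m\<^sup>2 + 5" by simp
      also have "\<dots> = 27 * q^3 + 36 * q\<^sup>2 + 6 * q + 2"
        unfolding q(1) by (simp add: algebra_simps eval_nat_numeral)
      finally have "27 * m^6 - 45 * m^4 + 15 * m\<^sup>2 + 5 = 27 * q^3 + 36 * q\<^sup>2 + 6 * q + 2" .
      moreover have "0 \<le> 27 * q^3 + 36 * q\<^sup>2 + 6 * q + 2" using q(2) by simp
      ultimately show ?thesis by linarith
    qed
    ultimately have "y + y^3 / 3 + y^5 / (5 * (1 - y\<^sup>2)) \<le> 1 / m"
      using pos pos2 m by (smt (verit, ccfv_SIG) divide_nonneg_pos mult_pos_pos zero_less_power)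
    with half_ln_step[of m "1/3"] m(1) have "ln (m\<^sup>2 + m + 1/3) / 2 - ln ((m - 1)\<^sup>2 + (m - 1) + 1/3) / 2 \<le> 1 / m"
      unfolding y_def by simp
    then show ?thesis unfolding v_def harm_Suc m(2) m_def[symmetric] by (simp add: inverse_eq_divide)
  qed
  then have "incseq v" by (rule incseq_SucI)
  from incseq_le[OF this harm_minus_half_ln_LIMSEQ[of "1/3", folded v_def], of 20] show ?thesis by (simp add: v_def)
qed

lemma euler_mascheroni_le: "(euler_mascheroni :: real) \<le> harm 20 - ln 420.3327 / 2"
proof -
  \<comment> \<open>Slightly below 1/3, so that 1 - 3 c = 0.0019 is positive and (1 - 3 c) m^4
    outweighs 6 c^2 m^2 + 3 c^3 for all m \<ge> 21, that is, for every increment beyond n =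
    20.\<close>
  define c :: real where "c = 0.3327"
  define v where "v n = harm n - ln ((real n)\<^sup>2 + real n + c) / 2" for n
  have "v (Suc (n + 20)) \<le> v (n + 20)" for n
  proof -
    define m where "m = real (Suc (n + 20))"
    define y where "y = m / (m\<^sup>2 + c)"
    have m: "21 \<le> m" "real (n + 20) = m - 1" by (auto simp: m_def)
    have m2: "441 \<le> m\<^sup>2" using m power_mono[of 21 m 2] by simp
    define a where "a = m\<^sup>2 + c"
    have a: "0 < a" using m2 by (simp add: a_def c_def)
    have "3 * c * a\<^sup>2 \<le> m^4"
    proof -
      have "m^4 - 3 * c * a\<^sup>2 = m\<^sup>2 * m\<^sup>2 * (1 - 3 * c) - 6 * c\<^sup>2 * m\<^sup>2 - 3 * c ^ 3"
        by (simp add: a_def eval_nat_numeral algebra_simps)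
      moreover have "m\<^sup>2 * 441 \<le> m\<^sup>2 * m\<^sup>2" using m2 by (intro mult_left_mono) auto
      ultimately show ?thesis using m2 by (simp add: c_def power2_eq_square power3_eq_cube)
    qed
    then have "(m^4 - 3 * c * a\<^sup>2) / (3 * m * a^3) \<ge> 0" using a m by simp
    also have "(m^4 - 3 * c * a\<^sup>2) / (3 * m * a^3) = y + y^3 / 3 - 1 / m"
    proof -
      have "(m^4 - 3 * c * a\<^sup>2) / (3 * m * a^3) = m / a + (m / a)^3 / 3 - (a - c + c) / (m * a)"
        using a m by (simp add: divide_simps a_def[symmetric] power_divide)
          (simp add: a_def eval_nat_numeral algebra_simps)
      then show ?thesis using a m by (simp add: y_def a_def[symmetric])
    qed
    finally have "1 / m \<le> y + y^3 / 3" by simp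
    with half_ln_step[of m c] m(1) have "1 / m \<le> ln (m\<^sup>2 + m + c) / 2 - ln ((m - 1)\<^sup>2 + (m - 1) + c) / 2"
      unfolding y_def by (simp add: c_def)
    then show ?thesis unfolding v_def harm_Suc m(2) m_def[symmetric] by (simp add: inverse_eq_divide)
  qed
  then have "decseq (\<lambda>n. v (n + 20))" by (intro decseq_SucI) simp
  from decseq_ge[OF this LIMSEQ_ignore_initial_segment[OF harm_minus_half_ln_LIMSEQ[of c, folded v_def]], of 0]
  show ?thesis by (simp add: v_def c_def)
qed

section \<open>The constant and the main theorem\<close>

text \<open>The factor is (q^2 - q + 1) / (q (q - 1)), and q^2 - q + 1 is what remains of q^6 - 1
  after removing (q + 1) (q^3 - 1). The first identity evaluates the product over all primes; the
  second separates the Mertens factor from the local density.\<close>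

lemma euler_factor_prime:
  assumes "prime p"
  shows "euler_factor p = (1 - real p powr - 6) / ((1 - real p powr - 2) * (1 - real p powr - 3))"
    and "1 - 1 / real p + 1 / (real p)\<^sup>2 = (1 - 1 / real p) * euler_factor p"
proof -
  define q where "q = real p"
  have q: "1 < q" using prime_gt_1_nat[OF assms] by (simp add: q_def)
  have powr: "q powr - 6 = 1 / q ^ 6" "q powr - 2 = 1 / q ^ 2" "q powr - 3 = 1 / q ^ 3"
    using q by (simp_all add: powr_minus divide_inverse)
  have "1 < q\<^sup>2" "1 < q ^ 3" using q by (auto intro: one_less_power)
  then have nz: "q \<noteq> 0" "q - 1 \<noteq> 0" "q\<^sup>2 - 1 \<noteq> 0" "q ^ 3 - 1 \<noteq> 0" using q by linarith+
  have "(1 - q powr - 6) / ((1 - q powr - 2) * (1 - q powr - 3)) =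
      (q ^ 6 - 1) / q ^ 6 / (((q\<^sup>2 - 1) / q\<^sup>2) * ((q ^ 3 - 1) / q ^ 3))"
    using nz(1) by (simp add: powr diff_divide_distrib)
  also have "\<dots> = (q ^ 6 - 1) / (q * ((q\<^sup>2 - 1) * (q ^ 3 - 1)))"
    using nz by (simp add: divide_simps) (simp add: eval_nat_numeral)
  also have "(q ^ 6 - 1) = (q\<^sup>2 - q + 1) * ((q + 1) * (q ^ 3 - 1))"
    by (simp add: eval_nat_numeral algebra_simps)
  also have "q * ((q\<^sup>2 - 1) * (q ^ 3 - 1)) = (q * (q - 1)) * ((q + 1) * (q ^ 3 - 1))"
    by (simp add: eval_nat_numeral algebra_simps)
  also have "((q\<^sup>2 - q + 1) * ((q + 1) * (q ^ 3 - 1))) / ((q * (q - 1)) * ((q + 1) * (q ^ 3 - 1))) =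
      (q\<^sup>2 - q + 1) / (q * (q - 1))"
    using nz q by simp
  also have "\<dots> = 1 + 1 / (q * (q - 1))"
    using nz by (simp add: divide_simps) (simp add: power2_eq_square algebra_simps)
  finally show "euler_factor p = (1 - real p powr - 6) / ((1 - real p powr - 2) * (1 - real p powr - 3))"
    using assms by (simp add: euler_factor_def q_def)
  have "1 - 1 / q + 1 / q\<^sup>2 = (1 - 1 / q) * (1 + 1 / (q * (q - 1)))"
    using nz by (simp add: divide_simps) (simp add: power2_eq_square algebra_simps)
  then show "1 - 1 / real p + 1 / (real p)\<^sup>2 = (1 - 1 / real p) * euler_factor p"
    using assms by (simp add: euler_factor_def q_def)
qed

lemma prod_euler_factor_atMost: "(\<Prod>n\<le>N. euler_factor n) = (\<Prod>p | prime p \<and> p \<le> N. euler_factor p)"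
  by (intro prod.mono_neutral_right) (auto simp: euler_factor_def)

lemma euler_factor_LIMSEQ:
  "(\<lambda>N. \<Prod>n\<le>N. euler_factor n) \<longlonglongrightarrow> zeta_sum 2 * zeta_sum 3 / zeta_sum 6"
proof -
  define E where "E s N = (\<Prod>p | prime p \<and> p \<le> N. 1 - real p powr - s)" for s :: real and N :: nat
  have lim: "E s \<longlonglongrightarrow> 1 / zeta_sum s" if "1 < s" for s
    using tendsto_divide[OF euler_product_zeta[OF that, folded E_def] tendsto_const[of "zeta_sum s"]]
      zeta_sum_ge_1[OF that] by simp
  have "(\<lambda>N. E 6 N / (E 2 N * E 3 N)) \<longlonglongrightarrow> (1 / zeta_sum 6) / ((1 / zeta_sum 2) * (1 / zeta_sum 3))"
    using zeta_sum_ge_1[of 2] zeta_sum_ge_1[of 3] by (intro tendsto_intros lim) auto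
  also have "(\<lambda>N. E 6 N / (E 2 N * E 3 N)) = (\<lambda>N. \<Prod>n\<le>N. euler_factor n)"
    unfolding prod_euler_factor_atMost E_def prod.distrib[symmetric] prod_dividef[symmetric]
    by (intro ext prod.cong refl) (simp add: euler_factor_prime(1))
  finally show ?thesis by simp
qed

text \<open>\<open>convergent_prod\<close> demands a nonzero limit when no factor vanishes, hence
  the appeal to the zeta values being at least 1.\<close>

lemma euler_factor_product:
  shows "convergent_prod euler_factor" and "prodinf euler_factor = zeta_sum 2 * zeta_sum 3 / zeta_sum 6"
proof -
  have nz: "euler_factor n \<noteq> 0" for n
    using prime_gt_1_nat[of n] by (auto simp: euler_factor_def add_nonneg_eq_0_iff)
  have "zeta_sum 2 * zeta_sum 3 / zeta_sum 6 \<noteq> 0"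
    using zeta_sum_ge_1[of 2] zeta_sum_ge_1[of 3] zeta_sum_ge_1[of 6] by auto
  then show *: "convergent_prod euler_factor"
    using euler_factor_LIMSEQ nz by (auto simp: convergent_prod_iff_nz_lim)
  show "prodinf euler_factor = zeta_sum 2 * zeta_sum 3 / zeta_sum 6"
    using convergent_prod_LIMSEQ[OF *] euler_factor_LIMSEQ by (rule LIMSEQ_unique)
qed

lemma c_const_eq: "c_const = exp (- euler_mascheroni) * (zeta_sum 2 * zeta_sum 3 / zeta_sum 6)"
  by (simp add: c_const_def euler_factor_product)

section \<open>Numerical value of the constant\<close>

text \<open>Dividing by 4 brings the argument below 1, where 12 Taylor terms suffice. The decimals
  0.89943491 and 0.89943492 enclose harm 20 / 4.\<close>

lemma exp_harm_20_bounds: "2.4582136 \<le> exp (harm 20 / 4 :: real)" "exp (harm 20 / 4 :: real) \<le> 2.4582137"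
proof -
  have H: "(harm 20 :: real) = 55835135 / 15519504" by (simp add: harm_expand)
  have taylor: "\<exists>t. \<bar>t\<bar> \<le> \<bar>x\<bar> \<and> exp x = (\<Sum>m<12. x ^ m / fact m) + exp t / fact 12 * x ^ 12" for x :: real
    using Maclaurin_exp_le[of x 12] by blast
  obtain t where "exp (0.89943491::real) = (\<Sum>m<12. 0.89943491 ^ m / fact m) + exp t / fact 12 * 0.89943491 ^ 12"
    using taylor by blast
  then have "(\<Sum>m<12. 0.89943491 ^ m / fact m) \<le> exp (0.89943491::real)" by simp
  moreover have "2.4582136 \<le> (\<Sum>m<12. 0.89943491 ^ m / fact m :: real)"
    by (simp add: eval_nat_numeral)
  ultimately have "2.4582136 \<le> exp (0.89943491::real)" by (rule order_trans[rotated])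
  also have "\<dots> \<le> exp (harm 20 / 4)" by (simp add: H)
  finally show "2.4582136 \<le> exp (harm 20 / 4 :: real)" .
  obtain t where t: "\<bar>t\<bar> \<le> 0.89943492"
    "exp (0.89943492::real) = (\<Sum>m<12. 0.89943492 ^ m / fact m) + exp t / fact 12 * 0.89943492 ^ 12"
    using taylor[of "0.89943492"] by auto
  have "exp t \<le> exp 1" using t(1) by simp
  then have "exp t \<le> 3" using exp_le by (rule order_trans)
  then have "exp t / fact 12 * 0.89943492 ^ 12 \<le> 3 / fact 12 * 1"
    by (intro mult_mono divide_right_mono power_le_one) auto
  then have "exp (0.89943492::real) \<le> (\<Sum>m<12. 0.89943492 ^ m / fact m) + 3 / fact 12" using t(2) by simp
  also have "\<dots> \<le> 2.4582137" by (simp add: eval_nat_numeral)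
  finally have *: "exp (0.89943492::real) \<le> 2.4582137" .
  have "exp (harm 20 / 4 :: real) \<le> exp 0.89943492" by (simp add: H)
  with * show "exp (harm 20 / 4 :: real) \<le> 2.4582137" by (rule order_trans[rotated])
qed

lemma exp_minus_euler_mascheroni_bounds:
  "0.561459 \<le> exp (- euler_mascheroni :: real)" "exp (- euler_mascheroni :: real) \<le> 0.5614597"
proof -
  define E where "E = exp (harm 20 / 4 :: real)"
  have E: "2.4582136 \<le> E" "E \<le> 2.4582137" unfolding E_def by (rule exp_harm_20_bounds)+
  \<comment> \<open>Squaring removes the square root that half a logarithm produces; exp (2 harm 20)
    is then the eighth power of E, and only rational arithmetic remains.\<close>
  have sq: "(exp (- (harm 20 - ln a / 2)))\<^sup>2 = a / E ^ 8" if "0 < a" for a :: real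
  proof -
    have "(exp (- (harm 20 - ln a / 2)))\<^sup>2 = exp (ln a - 8 * (harm 20 / 4))"
      by (simp add: algebra_simps flip: exp_double)
    then show ?thesis using that exp_of_nat_mult[of 8 "harm 20 / 4 :: real"] by (simp add: E_def exp_diff)
  qed
  have "(0.561459::real)\<^sup>2 \<le> 420.3327 / 2.4582137 ^ 8" by (simp add: eval_nat_numeral)
  also have "\<dots> \<le> 420.3327 / E ^ 8"
    using E by (intro divide_left_mono power_mono) auto
  also have "\<dots> = (exp (- (harm 20 - ln 420.3327 / 2)))\<^sup>2" by (rule sq[symmetric]) simp
  also have "\<dots> \<le> (exp (- euler_mascheroni))\<^sup>2"
    using euler_mascheroni_le by (intro power_mono) auto
  finally show "0.561459 \<le> exp (- euler_mascheroni :: real)" by (rule power2_le_imp_le) simp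
  have "(exp (- euler_mascheroni :: real))\<^sup>2 \<le> (exp (- (harm 20 - ln (420 + 1/3) / 2)))\<^sup>2"
    using euler_mascheroni_ge by (intro power_mono) auto
  also have "\<dots> = (420 + 1/3) / E ^ 8" by (rule sq) simp
  also have "\<dots> \<le> (420 + 1/3) / 2.4582136 ^ 8"
    using E by (intro divide_left_mono power_mono) auto
  also have "\<dots> \<le> (0.5614597::real)\<^sup>2" by (simp add: eval_nat_numeral)
  finally show "exp (- euler_mascheroni :: real) \<le> 0.5614597" by (rule power2_le_imp_le) simp
qed

text \<open>The tolerance is half a unit in the last digit, so 1.09125 is c rounded to five
  decimals.\<close>

lemma c_const_approx: "\<bar>c_const - 1.09125\<bar> \<le> 5 / 10 ^ 6"
proof -
  define P where "P = zeta_sum 2 * zeta_sum 3 / zeta_sum 6"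
  have "(3.14159265::real)\<^sup>2 \<le> pi\<^sup>2" "pi\<^sup>2 \<le> (3.14159266::real)\<^sup>2"
    using pi_approx by (intro power_mono; simp)+
  then have z2: "1.644934 \<le> zeta_sum 2" "zeta_sum 2 \<le> 1.6449341"
    unfolding zeta_2 by (simp_all add: power2_eq_square)
  note z = z2 zeta_3_bounds zeta_6_bounds
  have "1.644934 * 1.2020568 / 1.0173434 \<le> P"
    unfolding P_def using z by (intro frac_le mult_mono mult_nonneg_nonneg) auto
  then have P1: "1.943595 \<le> P" by simp
  have "P \<le> 1.6449341 * 1.202057 / 1.0173429"
    unfolding P_def using z by (intro frac_le mult_mono mult_nonneg_nonneg) auto
  then have P2: "P \<le> 1.943598" by simp
  have "0.561459 * 1.943595 \<le> c_const"
    unfolding c_const_eq P_def[symmetric]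
    using P1 exp_minus_euler_mascheroni_bounds by (intro mult_mono) auto
  moreover have "c_const \<le> 0.5614597 * 1.943598"
    unfolding c_const_eq P_def[symmetric]
    using P1 P2 exp_minus_euler_mascheroni_bounds by (intro mult_mono) auto
  ultimately show ?thesis unfolding abs_le_iff by simp
qed

text \<open>For x > 1, D x ln x is exactly exp of minus (Mertens sum - ln ln x), times the Euler
  product truncated at x. The two factors converge separately.\<close>

lemma D_asymp: "((\<lambda>x. D x * ln x) \<longlongrightarrow> c_const) at_top"
proof -
  define S where "S x = {p::nat. prime p \<and> real p \<le> x}" for x
  have fin: "finite (S x)" for x
    unfolding S_def by (rule finite_subset[of _ "{..nat \<lfloor>x\<rfloor>}"]) (auto simp: le_nat_floor)
  have "((\<lambda>x. exp (- ((\<Sum>p\<in>S x. - ln (1 - 1 / real p)) - ln (ln x)))) \<longlongrightarrow> exp (- euler_mascheroni)) at_top"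
    unfolding S_def by (intro tendsto_intros mertens_third_log)
  moreover have "filterlim (\<lambda>x::real. nat \<lfloor>x\<rfloor>) sequentially at_top"
    by (rule filterlim_compose[OF filterlim_nat_sequentially filterlim_floor_sequentially])
  from filterlim_compose[OF convergent_prod_LIMSEQ[OF euler_factor_product(1)] this]
  have "((\<lambda>x. \<Prod>n\<le>nat \<lfloor>x\<rfloor>. euler_factor n) \<longlongrightarrow> prodinf euler_factor) (at_top :: real filter)" .
  ultimately have "((\<lambda>x. exp (- ((\<Sum>p\<in>S x. - ln (1 - 1 / real p)) - ln (ln x))) * (\<Prod>n\<le>nat \<lfloor>x\<rfloor>. euler_factor n))
    \<longlongrightarrow> c_const) at_top"
    unfolding c_const_def by (rule tendsto_mult)
  moreover have "\<forall>\<^sub>F x in at_top. exp (- ((\<Sum>p\<in>S x. - ln (1 - 1 / real p)) - ln (ln x))) * (\<Prod>n\<le>nat \<lfloor>x\<rfloor>. euler_factor n)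
     = D x * ln x"
    using eventually_gt_at_top[of 1]
  proof eventually_elim
    case (elim x)
    have pos: "0 < 1 - 1 / real p" if "p \<in> S x" for p
      using that prime_gt_1_nat[of p] by (simp add: S_def)
    have "exp (- ((\<Sum>p\<in>S x. - ln (1 - 1 / real p)) - ln (ln x))) = (\<Prod>p\<in>S x. exp (ln (1 - 1 / real p))) * ln x"
      using elim exp_sum[OF fin] by (simp add: sum_negf exp_add mult.commute)
    also have "(\<Prod>p\<in>S x. exp (ln (1 - 1 / real p))) = (\<Prod>p\<in>S x. 1 - 1 / real p)"
      using pos by (intro prod.cong) auto
    finally have 1: "exp (- ((\<Sum>p\<in>S x. - ln (1 - 1 / real p)) - ln (ln x))) = (\<Prod>p\<in>S x. 1 - 1 / real p) * ln x" .
    have "S x = {p. prime p \<and> p \<le> nat \<lfloor>x\<rfloor>}"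
      using elim by (auto simp: S_def le_nat_iff le_floor_iff)
    then have 2: "(\<Prod>n\<le>nat \<lfloor>x\<rfloor>. euler_factor n) = (\<Prod>p\<in>S x. euler_factor p)"
      by (simp add: prod_euler_factor_atMost)
    have "D x = (\<Prod>p\<in>S x. (1 - 1 / real p) * euler_factor p)"
      unfolding density_nonvanishing_set(2) S_def by (intro prod.cong) (auto simp: euler_factor_prime(2))
    then show ?case unfolding 1 2 by (simp add: prod.distrib)
  qed
  ultimately show ?thesis by (rule Lim_transform_eventually)
qed

lemma D_bounds: "0 < D x" "D x \<le> 1"
proof -
  have *: "0 < 1 - 1 / real p + 1 / (real p)\<^sup>2 \<and> 1 - 1 / real p + 1 / (real p)\<^sup>2 \<le> 1" if "prime p" for p
  proof -
    have p: "1 < real p" using prime_gt_1_nat[OF that] by simp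
    then have "1 / (real p)\<^sup>2 \<le> 1 / real p"
      by (intro divide_left_mono) (auto simp: power2_eq_square)
    then show ?thesis using p by (simp add: add_pos_pos)
  qed
  show "0 < D x" unfolding density_nonvanishing_set(2) using * by (intro prod_pos) auto
  show "D x \<le> 1" unfolding density_nonvanishing_set(2) using * by (intro prod_le_1) (auto simp: less_imp_le)
qed

text \<open>\<open>Lim\<close> and the infinite product are total operators, so existence of the
  density and convergence of the product are asserted as conjuncts of their own.\<close>

theorem mainTheorem1:
  shows "(\<forall>x\<ge>2. has_natural_density (nonvanishing_set x) (D x))
    \<and> (\<exists>C. \<forall>x\<ge>2. \<bar>D x\<bar> \<le> C / ln x)
    \<and> convergent_prod euler_factor
    \<and> (D \<sim>[at_top] (\<lambda>x. c_const / ln x))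
    \<and> \<bar>c_const - 1.09125\<bar> \<le> 5 / 10 ^ 6"
proof (intro conjI)
  show "\<forall>x\<ge>2. has_natural_density (nonvanishing_set x) (D x)"
    using density_nonvanishing_set by simp
  show "convergent_prod euler_factor" by (rule euler_factor_product)
  show "\<bar>c_const - 1.09125\<bar> \<le> 5 / 10 ^ 6" by (rule c_const_approx)
  then have c: "0 < c_const" unfolding abs_le_iff by simp
  show "D \<sim>[at_top] (\<lambda>x. c_const / ln x)"
  proof (rule asymp_equivI')
    have "((\<lambda>x. D x * ln x / c_const) \<longlongrightarrow> c_const / c_const) at_top"
      using c by (intro tendsto_divide D_asymp tendsto_const) auto
    then show "((\<lambda>x. D x / (c_const / ln x)) \<longlongrightarrow> 1) at_top" using c by simp
  qed
  have "\<forall>\<^sub>F x in at_top. D x * ln x < c_const + 1"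
    using D_asymp by (rule order_tendstoD) simp
  then obtain X where X: "\<And>x. X \<le> x \<Longrightarrow> D x * ln x < c_const + 1"
    by (auto simp: eventually_at_top_linorder)
  show "\<exists>C. \<forall>x\<ge>2. \<bar>D x\<bar> \<le> C / ln x"
  proof (intro exI allI impI)
    fix x :: real assume x: "2 \<le> x"
    \<comment> \<open>The asymptotics control only x \<ge> X. Below X the trivial bound D x \<le> 1
      and monotonicity of ln take over.\<close>
    have "D x * ln x \<le> max (c_const + 1) (ln (max X 2))"
    proof (cases "X \<le> x")
      case True
      then show ?thesis using X[of x] by simp
    next
      case False
      have "D x * ln x \<le> 1 * ln x" using x D_bounds(2) by (intro mult_right_mono) auto
      also have "\<dots> \<le> ln (max X 2)" using x False by simp
      finally show ?thesis by simp
    qed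
    then show "\<bar>D x\<bar> \<le> max (c_const + 1) (ln (max X 2)) / ln x"
      using x D_bounds(1)[of x] by (simp add: pos_le_divide_eq)
  qed
qed

end
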